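(* Let $0<a<b<\infty$ and assign to the edges of the $\mathbb{Z}^2$ nearest-neighbour lattice independent weights, each uniformly distributed on $\{a,b\}$. Let $(k_n)$ be positive integers with $k_n=o(n^{1/22})$. For every $\beta\in(0,1)$ and any $\beta$-quantile $q_\beta=q_\beta(n)$ of $\tau^\star(n,k_n)$, $$\lim_{n\to\infty}\mathbb{P}\big(\tau^\star(n,k_n)<q_\beta\big)=1-\lim_{n\to\infty}\mathbb{P}\big(\tau^\star(n,k_n)>q_\beta\big)=\beta,$$ and the sequence $f^\star_n:=\mathbbm{1}_{\{\tau^\star(n,k_n)>q_\beta\}}$ is noise sensitive.
   Context: For a path $\Gamma$, $T(\Gamma):=\sum_{e\in\Gamma}\omega_e$. $t_i(n,k)$ denotes the left-right crossing time of the rectangle $[0,n]\times[i,i+k-1]$: the infimum of $T(\Gamma)$ over nearest-neighbour paths in that rectangle connecting its left side $\{0\}\times[i,i+k-1]$ to its right side $\{n\}\times[i,i+k-1]$. Set $\tau^\star(n,k):=\min\{t_{(i-1)k}(n,k):i=1,\dots,\lfloor n/k\rfloor\}$. A $\beta$-quantile of $X$ is any $q$ with $\mathbb{P}(X<q)\le\beta\le\mathbb{P}(X\le q)$. Each $f^\star_n$ depends on finitely many weights, viewed as a function on $\{a,b\}^{E_n}$ with uniform product measure; $\omega^\varepsilon$ is obtained from $\omega$ by independently resampling each weight with probability $\varepsilon$; $(f_n)$ is noise sensitive if for every $\varepsilon>0$, $\mathbb{E}[f_n(\omega)f_n(\omega^\varepsilon)]-\mathbb{E}[f_n(\omega)]^2\to0$.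 *)

theory Defs
  imports "HOL-Probability.Probability" "HOL-Library.Landau_Symbols"
begin

type_synonym vtx = "int \<times> int"
type_synonym edge = "vtx \<times> vtx"

definition adj :: "vtx \<Rightarrow> vtx \<Rightarrow> bool" where
  "adj p q \<longleftrightarrow> \<bar>fst p - fst q\<bar> + \<bar>snd p - snd q\<bar> = 1"

definition Zedges :: "edge set" where
  "Zedges = {(p, q). q = (fst p + 1, snd p) \<or> q = (fst p, snd p + 1)}"

definition canon_edge :: "vtx \<Rightarrow> vtx \<Rightarrow> edge" where
  "canon_edge p q = (if fst p < fst q \<or> (fst p = fst q \<and> snd p \<le> snd q) then (p, q) else (q, p))"

definition nn_path :: "vtx list \<Rightarrow> bool" where
  "nn_path xs \<longleftrightarrow> xs \<noteq> [] \<and> (\<forall>j. Suc j < length xs \<longrightarrow> adj (xs ! j) (xs ! Suc j))"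

definition path_edges :: "vtx list \<Rightarrow> edge set" where
  "path_edges xs = {canon_edge (xs ! j) (xs ! Suc j) | j. Suc j < length xs}"

definition passage_time :: "(edge \<Rightarrow> real) \<Rightarrow> vtx list \<Rightarrow> real" where
  "passage_time \<omega> xs = (\<Sum>e\<in>path_edges xs. \<omega> e)"

definition rect :: "nat \<Rightarrow> nat \<Rightarrow> int \<Rightarrow> vtx set" where
  "rect n k i = {0..int n} \<times> {i..i + int k - 1}"

definition crossing_paths :: "nat \<Rightarrow> nat \<Rightarrow> int \<Rightarrow> vtx list set" where
  "crossing_paths n k i = {xs. nn_path xs \<and> set xs \<subseteq> rect n k i
      \<and> fst (hd xs) = 0 \<and> fst (last xs) = int n}"

definition crossing_time :: "(edge \<Rightarrow> real) \<Rightarrow> nat \<Rightarrow> nat \<Rightarrow> int \<Rightarrow> real" where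
  "crossing_time \<omega> n k i = Inf (passage_time \<omega> ` crossing_paths n k i)"

definition tau_star :: "(edge \<Rightarrow> real) \<Rightarrow> nat \<Rightarrow> nat \<Rightarrow> real" where
  "tau_star \<omega> n k = Min ((\<lambda>i. crossing_time \<omega> n k (int ((i - 1) * k))) ` {1..n div k})"

text \<open>The finite set E_n of edges on which tau^*(n,k) depends: edges with both endpoints
  in [0,n] x [0, floor(n/k) k - 1], the union of the rectangles used in tau^*.\<close>
definition relevant_edges :: "nat \<Rightarrow> nat \<Rightarrow> edge set" where
  "relevant_edges n k = {e \<in> Zedges.
      fst e \<in> {0..int n} \<times> {0..int ((n div k) * k) - 1} \<and>
      snd e \<in> {0..int n} \<times> {0..int ((n div k) * k) - 1}}"

text \<open>Uniform product measure on {a,b}^E (value outside E fixed, irrelevant).\<close>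
definition weight_pmf :: "real \<Rightarrow> real \<Rightarrow> edge set \<Rightarrow> (edge \<Rightarrow> real) pmf" where
  "weight_pmf a b E = Pi_pmf E a (\<lambda>_. pmf_of_set {a, b})"

definition resample_one :: "real \<Rightarrow> real \<Rightarrow> real \<Rightarrow> (real \<times> real) pmf" where
  "resample_one a b \<epsilon> =
     do { x \<leftarrow> pmf_of_set {a, b};
          r \<leftarrow> bernoulli_pmf \<epsilon>;
          y \<leftarrow> pmf_of_set {a, b};
          return_pmf (x, if r then y else x) }"

definition noise_pmf :: "real \<Rightarrow> real \<Rightarrow> real \<Rightarrow> edge set \<Rightarrow> ((edge \<Rightarrow> real) \<times> (edge \<Rightarrow> real)) pmf" where
  "noise_pmf a b \<epsilon> E =
     map_pmf (\<lambda>F. (\<lambda>e. fst (F e), \<lambda>e. snd (F e))) (Pi_pmf E (a, a) (\<lambda>_. resample_one a b \<epsilon>))"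

definition noise_sensitive ::
    "real \<Rightarrow> real \<Rightarrow> (nat \<Rightarrow> edge set) \<Rightarrow> (nat \<Rightarrow> (edge \<Rightarrow> real) \<Rightarrow> real) \<Rightarrow> bool" where
  "noise_sensitive a b E f \<longleftrightarrow>
     (\<forall>\<epsilon>>0. (\<lambda>n. measure_pmf.expectation (noise_pmf a b \<epsilon> (E n)) (\<lambda>(\<omega>, \<omega>'). f n \<omega> * f n \<omega>')
                 - (measure_pmf.expectation (weight_pmf a b (E n)) (f n))\<^sup>2) \<longlonglongrightarrow> 0)"

definition is_quantile :: "'a pmf \<Rightarrow> ('a \<Rightarrow> real) \<Rightarrow> real \<Rightarrow> real \<Rightarrow> bool" where
  "is_quantile M X \<beta> q \<longleftrightarrow>
     measure_pmf.prob M {x. X x < q} \<le> \<beta> \<and> \<beta> \<le> measure_pmf.prob M {x. X x \<le> q}"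

end

theory Submission
  imports Defs "HOL-Real_Asymp.Real_Asymp"
begin

text \<open>
  \<open>\<tau>\<^sup>*\<close> is the minimum of \<open>m = \<lfloor>n/k\<rfloor>\<close> independent copies of the crossing time \<open>X\<close> of one strip with
  \<open>n\<close> columns and \<open>k\<close> rows.

  Noise sensitivity of such a minimum is automatic: it amounts to \<open>m Q \<rightarrow> 0\<close>, where \<open>Q\<close> is the
  probability that \<open>X \<le> q\<close> both before and after the noise. Hypercontractivity gives
  \<open>Q \<le> P\<^bsup>2/r\<^esup>\<close> for \<open>P = \<P>(X \<le> q)\<close> and some \<open>r < 2\<close>, while \<open>m P\<close> is bounded by the choice of \<open>q\<close>.

  It remains to see that \<open>\<tau>\<^sup>*\<close> has no large atom at \<open>q\<close>, that is \<open>m \<P>(X = q) \<rightarrow> 0\<close>. Reveal the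
  configuration as a uniformly random decreasing sequence of sets of \<open>b\<close>-edges. Whenever a geodesic
  contains at least \<open>M\<close> of the \<open>N\<close> edges as \<open>b\<close>-edges, the next removal makes \<open>X\<close> drop with
  probability at least \<open>M/N\<close>, so \<open>X = q\<close> holds for about \<open>N/M\<close> steps only. A binomial weight is at most
  \<open>2/L\<close> times its lower tail, up to moderate deviations of order \<open>N/L\<close>, whence
  \<open>\<P>(X = q) \<le> 2N/(ML) \<P>(X < q)\<close> up to negligible errors; here \<open>L\<close> is about \<open>n\<^bsup>1/4\<^esup>\<close>.
  Finally \<open>M = m/8\<close> is admissible because, by planar self-duality, a \<open>k \<times> k\<close> block has an \<open>a\<close>-crossing
  with probability at most one half, and a geodesic has a \<open>b\<close>-edge in each block without one.
\<close>

section \<open>Planar duality in a square\<close>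

text \<open>On the square with vertices \<open>{0..k} \<times> {0..k-1}\<close>, \<open>h x y\<close> is the edge from \<open>(x, y)\<close> to \<open>(x + 1, y)\<close>, but
  \<open>v x y\<close> is the edge from \<open>(x + 1, y)\<close> to \<open>(x + 1, y + 1)\<close>: with this shift, planar duality is
  transposition of both \<open>h\<close> and \<open>v\<close>.\<close>
inductive reach :: "(nat \<Rightarrow> nat \<Rightarrow> bool) \<Rightarrow> (nat \<Rightarrow> nat \<Rightarrow> bool) \<Rightarrow> nat \<Rightarrow> nat \<Rightarrow> nat \<Rightarrow> bool"
  for h v k where
  left: "y < k \<Longrightarrow> reach h v k 0 y"
| hor: "reach h v k x y \<Longrightarrow> x < k \<Longrightarrow> h x y \<Longrightarrow> reach h v k (Suc x) y"
| hor_back: "reach h v k (Suc x) y \<Longrightarrow> h x y \<Longrightarrow> reach h v k x y"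
| ver: "reach h v k (Suc x) y \<Longrightarrow> Suc x < k \<Longrightarrow> Suc y < k \<Longrightarrow> v x y \<Longrightarrow> reach h v k (Suc x) (Suc y)"
| ver_back: "reach h v k (Suc x) (Suc y) \<Longrightarrow> Suc x < k \<Longrightarrow> v x y \<Longrightarrow> reach h v k (Suc x) y"

definition crossed :: "(nat \<Rightarrow> nat \<Rightarrow> bool) \<Rightarrow> (nat \<Rightarrow> nat \<Rightarrow> bool) \<Rightarrow> nat \<Rightarrow> bool" where
  "crossed h v k \<longleftrightarrow> (\<exists>y. reach h v k k y)"

lemma reach_bounds: "reach h v k x y \<Longrightarrow> x \<le> k \<and> y < k"
  by (induction rule: reach.induct) auto

lemma reach_mono:
  assumes "reach h v k x y"
    and "\<And>x y. x < k \<Longrightarrow> y < k \<Longrightarrow> h x y \<Longrightarrow> h' x y"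
    and "\<And>x y. Suc x < k \<Longrightarrow> Suc y < k \<Longrightarrow> v x y \<Longrightarrow> v' x y"
  shows "reach h' v' k x y"
  using assms(1)
proof (induction rule: reach.induct)
  case (left y)
  then show ?case by (rule reach.left)
next
  case (hor x y)
  then show ?case using assms(2)[of x y] reach_bounds[OF hor.hyps(1)] by (intro reach.hor[OF hor.IH]) auto
next
  case (hor_back x y)
  then show ?case using assms(2)[of x y] reach_bounds[OF hor_back.hyps(1)] by (intro reach.hor_back[OF hor_back.IH]) auto
next
  case (ver x y)
  then show ?case using assms(3)[of x y] by (intro reach.ver[OF ver.IH]) auto
next
  case (ver_back x y)
  then show ?case using assms(3)[of x y] reach_bounds[OF ver_back.hyps(1)] by (intro reach.ver_back[OF ver_back.IH]) auto
qed

lemma crossed_cong: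
  assumes "\<And>x y. x < k \<Longrightarrow> y < k \<Longrightarrow> h x y = h' x y"
    and "\<And>x y. Suc x < k \<Longrightarrow> Suc y < k \<Longrightarrow> v x y = v' x y"
  shows "crossed h v k = crossed h' v' k"
proof -
  have "reach h v k x y \<longleftrightarrow> reach h' v' k x y" for x y
    by (intro iffI; erule reach_mono) (simp_all add: assms)
  then have "reach h v k = reach h' v' k" by (intro ext)
  then show ?thesis unfolding crossed_def by simp
qed

text \<open>The potential \<open>\<phi>\<close> is a cut function of the dual path from the bottom side to the dual vertex
  \<open>(y + 1/2, x - 1/2)\<close>, prolonged by the vertical dual ray from that vertex to the top side.\<close>
definition separates ::
    "(nat \<Rightarrow> nat \<Rightarrow> bool) \<Rightarrow> (nat \<Rightarrow> nat \<Rightarrow> bool) \<Rightarrow> nat \<Rightarrow> nat \<Rightarrow> nat \<Rightarrow> (nat \<Rightarrow> nat \<Rightarrow> bool) \<Rightarrow> bool" where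
  "separates h v k x y \<phi> \<longleftrightarrow>
    (\<forall>r<k. \<not> \<phi> 0 r \<and> \<phi> k r) \<and>
    (\<forall>c<k. \<forall>r<k. h c r \<longrightarrow> \<phi> (Suc c) r = (\<phi> c r \<noteq> (c = y \<and> x \<le> r))) \<and>
    (\<forall>c r. Suc c < k \<longrightarrow> Suc r < k \<longrightarrow> v c r \<longrightarrow> \<phi> (Suc c) (Suc r) = \<phi> (Suc c) r)"

text \<open>The dual step runs along a piece of the ray, so the cut curve stays the same. Only the
  edge \<open>h y x\<close> changes from crossing the ray to crossing the path, and as it is closed
  no condition concerns it.\<close>

lemma separates_hor:
  assumes "\<not> h y x"
  shows "separates h v k (Suc x) y \<phi> = separates h v k x y \<phi>"
proof -
  have "(c = y \<and> Suc x \<le> r) = (c = y \<and> x \<le> r)" if "h c r" for c r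
    using that assms by (cases "r = x") auto
  then have "(h c r \<longrightarrow> \<phi> (Suc c) r = (\<phi> c r \<noteq> (c = y \<and> Suc x \<le> r))) =
      (h c r \<longrightarrow> \<phi> (Suc c) r = (\<phi> c r \<noteq> (c = y \<and> x \<le> r)))" for c r
    by blast
  then show ?thesis unfolding separates_def by (simp only:)
qed

text \<open>The ray moves sideways across the vertices of column \<open>Suc m\<close> at height at
  least \<open>Suc x\<close>, and these change sides. The only vertical edge with exactly one end
  among them is \<open>v m x\<close>, which is closed; \<open>Suc m < k\<close> keeps the column
  away from both sides of the square, where \<open>\<phi>\<close> is prescribed.\<close>

lemma separates_ver:
  assumes "separates h v k (Suc x) y \<phi>" and "\<not> v m x"
    and "y = m \<and> y' = Suc m \<or> y = Suc m \<and> y' = m" and "Suc m < k"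
  shows "separates h v k (Suc x) y' (\<lambda>c r. \<phi> c r \<noteq> (c = Suc m \<and> Suc x \<le> r))"
proof -
  have hor: "\<phi> (Suc c) r = (\<phi> c r \<noteq> (c = y \<and> Suc x \<le> r))" if "c < k" "r < k" "h c r" for c r
    using assms(1) that unfolding separates_def by blast
  have ver: "\<phi> (Suc c) (Suc r) = \<phi> (Suc c) r" if "Suc c < k" "Suc r < k" "v c r" for c r
    using assms(1) that unfolding separates_def by blast
  have "(Suc c = Suc m \<and> Suc x \<le> Suc r) = (Suc c = Suc m \<and> Suc x \<le> r)" if "v c r" for c r
  proof (cases "c = m")
    case True
    with that assms(2) have "r \<noteq> x" by blast
    then show ?thesis by linarith
  qed simp
  then have 1: "(\<phi> (Suc c) (Suc r) \<noteq> (Suc c = Suc m \<and> Suc x \<le> Suc r)) = (\<phi> (Suc c) r \<noteq> (Suc c = Suc m \<and> Suc x \<le> r))"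
    if "Suc c < k" "Suc r < k" "v c r" for c r
    using ver[OF that] that(3) by simp
  have 2: "(\<phi> (Suc c) r \<noteq> (Suc c = Suc m \<and> Suc x \<le> r)) =
      ((\<phi> c r \<noteq> (c = Suc m \<and> Suc x \<le> r)) \<noteq> (c = y' \<and> Suc x \<le> r))" if "c < k" "r < k" "h c r" for c r
    using hor[OF that] assms(3)
    by (elim disjE conjE; cases "Suc x \<le> r"; cases "c = m"; cases "c = Suc m"; simp)
  have 3: "\<not> \<phi> 0 r" "\<phi> k r" if "r < k" for r
    using assms(1) that unfolding separates_def by auto
  show ?thesis
    unfolding separates_def
  proof (intro conjI allI impI)
    fix r assume "r < k"
    then show "\<not> (\<phi> 0 r \<noteq> (0 = Suc m \<and> Suc x \<le> r))" "\<phi> k r \<noteq> (k = Suc m \<and> Suc x \<le> r)"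
      using 3[of r] assms(4) by simp_all
  next
    fix c r assume "c < k" "r < k" "h c r"
    then show "(\<phi> (Suc c) r \<noteq> (Suc c = Suc m \<and> Suc x \<le> r)) =
        ((\<phi> c r \<noteq> (c = Suc m \<and> Suc x \<le> r)) \<noteq> (c = y' \<and> Suc x \<le> r))" by (rule 2)
  next
    fix c r assume "Suc c < k" "Suc r < k" "v c r"
    then show "(\<phi> (Suc c) (Suc r) \<noteq> (Suc c = Suc m \<and> Suc x \<le> Suc r)) =
        (\<phi> (Suc c) r \<noteq> (Suc c = Suc m \<and> Suc x \<le> r))" by (rule 1)
  qed
qed

lemma dual_separates:
  assumes "reach (\<lambda>x y. \<not> h y x) (\<lambda>x y. \<not> v y x) k x y"
  shows "\<exists>\<phi>. separates h v k x y \<phi>"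
  using assms
proof (induction rule: reach.induct)
  case (left y)
  \<comment> \<open>At its start the dual path lies below the square, so the cut is the full
    vertical line between columns \<open>y\<close> and \<open>y + 1\<close>.\<close>
  then have "separates h v k 0 y (\<lambda>c r. c > y)"
    unfolding separates_def by auto
  then show ?case by (rule exI[where P = "separates h v k 0 y"])
next
  case (hor x y)
  then show ?case by (simp add: separates_hor)
next
  case (hor_back x y)
  then show ?case by (simp add: separates_hor)
next
  case (ver x y)
  then obtain \<phi> where "separates h v k (Suc x) y \<phi>" by auto
  from separates_ver[OF this, where m = y and y' = "Suc y"] ver.hyps show ?case by auto
next
  case (ver_back x y)
  then obtain \<phi> where "separates h v k (Suc x) (Suc y) \<phi>" by auto
  from separates_ver[OF this, where m = y and y' = y] ver_back.hyps reach_bounds[OF ver_back.hyps(1)]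
  show ?case by auto
qed

text \<open>Once the dual path is at the top, its ray meets no edge of the square. Hence
  \<open>\<phi>\<close> is constant along open edges, while it differs between the left and the
  right side.\<close>

lemma not_crossed_and_dual_crossed:
  assumes "crossed h v k"
  shows "\<not> crossed (\<lambda>x y. \<not> h y x) (\<lambda>x y. \<not> v y x) k"
proof
  assume "crossed (\<lambda>x y. \<not> h y x) (\<lambda>x y. \<not> v y x) k"
  then obtain y0 where "reach (\<lambda>x y. \<not> h y x) (\<lambda>x y. \<not> v y x) k k y0"
    unfolding crossed_def by blast
  from dual_separates[OF this] obtain \<phi> where sep: "separates h v k k y0 \<phi>" ..
  have \<phi>: "\<not> \<phi> 0 r" "\<phi> k r" if "r < k" for r
    using sep that unfolding separates_def by auto
  have step_hor: "\<phi> (Suc c) r = \<phi> c r" if "c < k" "r < k" "h c r" for c r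
    using sep that unfolding separates_def by auto
  have step_ver: "\<phi> (Suc c) (Suc r) = \<phi> (Suc c) r" if "Suc c < k" "Suc r < k" "v c r" for c r
    using sep that unfolding separates_def by blast
  have "\<not> \<phi> x y" if "reach h v k x y" for x y
    using that
  proof (induction rule: reach.induct)
    case (left y)
    then show ?case by (rule \<phi>)
  next
    case (hor x y)
    then show ?case using reach_bounds[OF hor.hyps(1)] step_hor by simp
  next
    case (hor_back x y)
    then show ?case using reach_bounds[OF hor_back.hyps(1)] step_hor[of x y] by simp
  next
    case (ver x y)
    then show ?case using step_ver[of x y] by simp
  next
    case (ver_back x y)
    then show ?case using reach_bounds[OF ver_back.hyps(1)] step_ver[of x y] by simp
  qed
  moreover from assms obtain y where "reach h v k k y" unfolding crossed_def by blast
  ultimately show False using \<phi>(2) reach_bounds by blast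
qed

section \<open>Independence of functions of disjoint coordinates\<close>

lemma expectation_pair_pmf_finite:
  fixes f :: "_ \<Rightarrow> real"
  assumes "finite (set_pmf p)" and "finite (set_pmf q)"
  shows "measure_pmf.expectation (pair_pmf p q) f =
    measure_pmf.expectation p (\<lambda>x. measure_pmf.expectation q (\<lambda>y. f (x, y)))"
proof -
  have "measure_pmf.expectation (pair_pmf p q) f =
      (\<Sum>z\<in>set_pmf p \<times> set_pmf q. f z * pmf (pair_pmf p q) z)"
    using assms by (intro integral_measure_pmf_real) auto
  also have "\<dots> = (\<Sum>x\<in>set_pmf p. \<Sum>y\<in>set_pmf q. f (x, y) * (pmf p x * pmf q y))"
    unfolding sum.cartesian_product by (intro sum.cong) (auto simp: pmf_pair)
  also have "\<dots> = (\<Sum>x\<in>set_pmf p. (\<Sum>y\<in>set_pmf q. f (x, y) * pmf q y) * pmf p x)"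
    by (simp add: sum_distrib_left sum_distrib_right mult_ac)
  also have "\<dots> = (\<Sum>x\<in>set_pmf p. measure_pmf.expectation q (\<lambda>y. f (x, y)) * pmf p x)"
    using assms by (intro sum.cong refl arg_cong2[where f = times] integral_measure_pmf_real[symmetric]) auto
  also have "\<dots> = measure_pmf.expectation p (\<lambda>x. measure_pmf.expectation q (\<lambda>y. f (x, y)))"
    using assms by (intro integral_measure_pmf_real[symmetric]) auto
  finally show ?thesis .
qed

definition depends_on :: "'i set \<Rightarrow> (('i \<Rightarrow> 'v) \<Rightarrow> 'r) \<Rightarrow> bool" where
  "depends_on A g \<longleftrightarrow> (\<forall>\<omega> \<omega>'. (\<forall>e\<in>A. \<omega> e = \<omega>' e) \<longrightarrow> g \<omega> = g \<omega>')"

lemma depends_onD: "depends_on A g \<Longrightarrow> (\<And>e. e \<in> A \<Longrightarrow> \<omega> e = \<omega>' e) \<Longrightarrow> g \<omega> = g \<omega>'"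
  unfolding depends_on_def by blast

lemma finite_set_Pi_pmf:
  assumes "finite A" and "\<And>x. finite (set_pmf (p x))"
  shows "finite (set_pmf (Pi_pmf A d p))"
  using assms by (simp add: set_Pi_pmf finite_PiE_dflt)

lemma expectation_Pi_pmf_subset:
  fixes g :: "_ \<Rightarrow> real"
  assumes "finite D" and "A \<subseteq> D" and "depends_on A g"
  shows "measure_pmf.expectation (Pi_pmf D d p) g = measure_pmf.expectation (Pi_pmf A d p) g"
proof -
  have "measure_pmf.expectation (Pi_pmf A d p) g =
      measure_pmf.expectation (Pi_pmf D d p) (\<lambda>f. g (\<lambda>x. if x \<in> A then f x else d))"
    by (simp add: Pi_pmf_subset[OF assms(1,2)])
  also have "\<dots> = measure_pmf.expectation (Pi_pmf D d p) g"
    by (intro Bochner_Integration.integral_cong refl depends_onD[OF assms(3)]) simp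
  finally show ?thesis ..
qed

lemma expectation_Pi_pmf_mult:
  fixes g h :: "_ \<Rightarrow> real"
  assumes "finite A" "finite B" "A \<inter> B = {}" "\<And>x. finite (set_pmf (p x))"
    and "depends_on A g" "depends_on B h"
  shows "measure_pmf.expectation (Pi_pmf (A \<union> B) d p) (\<lambda>\<omega>. g \<omega> * h \<omega>) =
    measure_pmf.expectation (Pi_pmf A d p) g * measure_pmf.expectation (Pi_pmf B d p) h"
proof -
  have *: "g (\<lambda>x. if x \<in> A then f x else f' x) = g f" "h (\<lambda>x. if x \<in> A then f x else f' x) = h f'" for f f'
    using assms(3) by (auto intro!: depends_onD[OF assms(5)] depends_onD[OF assms(6)])
  have "measure_pmf.expectation (Pi_pmf (A \<union> B) d p) (\<lambda>\<omega>. g \<omega> * h \<omega>) =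
      measure_pmf.expectation (pair_pmf (Pi_pmf A d p) (Pi_pmf B d p)) (\<lambda>(f, f'). g f * h f')"
    by (simp add: Pi_pmf_union[OF assms(1-3)] split_def *)
  also have "\<dots> = measure_pmf.expectation (Pi_pmf A d p) g * measure_pmf.expectation (Pi_pmf B d p) h"
    using assms by (simp add: expectation_pair_pmf_finite finite_set_Pi_pmf)
  finally show ?thesis .
qed

text \<open>By induction on \<open>I\<close>: the product measure on \<open>D\<close> is first
  reduced to the coordinates that the functions see, where it splits off the factor on
  \<open>E j\<close>.\<close>

lemma expectation_Pi_pmf_prod:
  fixes g :: "'j \<Rightarrow> ('i \<Rightarrow> 'v) \<Rightarrow> real"
  assumes "finite I" "finite D" "\<And>i. i \<in> I \<Longrightarrow> E i \<subseteq> D" "disjoint_family_on E I"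
    and "\<And>x. finite (set_pmf (p x))" and "\<And>i. i \<in> I \<Longrightarrow> depends_on (E i) (g i)"
  shows "measure_pmf.expectation (Pi_pmf D d p) (\<lambda>\<omega>. \<Prod>i\<in>I. g i \<omega>) =
    (\<Prod>i\<in>I. measure_pmf.expectation (Pi_pmf (E i) d p) (g i))"
  using assms(1,3,4,6)
proof (induction I rule: finite_induct)
  case empty
  then show ?case by simp
next
  case (insert j I)
  let ?U = "\<Union>i\<in>I. E i"
  have fin: "finite (E i)" if "i \<in> insert j I" for i
    using insert.prems(1) assms(2) that finite_subset by blast
  have disj: "E j \<inter> ?U = {}"
    using insert.prems(2) insert.hyps(2) unfolding disjoint_family_on_def by auto
  have dep: "depends_on ?U (\<lambda>\<omega>. \<Prod>i\<in>I. g i \<omega>)"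
    unfolding depends_on_def
    by (intro allI impI prod.cong refl depends_onD[OF insert.prems(3)]) auto
  have dep': "depends_on (E j \<union> ?U) (\<lambda>\<omega>. g j \<omega> * (\<Prod>i\<in>I. g i \<omega>))"
    using dep insert.prems(3)[of j] unfolding depends_on_def
    by (metis UnCI insertI1)
  have "measure_pmf.expectation (Pi_pmf D d p) (\<lambda>\<omega>. \<Prod>i\<in>insert j I. g i \<omega>) =
      measure_pmf.expectation (Pi_pmf (E j \<union> ?U) d p) (\<lambda>\<omega>. g j \<omega> * (\<Prod>i\<in>I. g i \<omega>))"
    using insert.hyps insert.prems(1)
    by (simp add: expectation_Pi_pmf_subset[OF assms(2) _ dep'] UN_least)
  also have "\<dots> = measure_pmf.expectation (Pi_pmf (E j) d p) (g j) *
      measure_pmf.expectation (Pi_pmf ?U d p) (\<lambda>\<omega>. \<Prod>i\<in>I. g i \<omega>)"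
    using fin insert.hyps(1) insert.prems(3)
    by (intro expectation_Pi_pmf_mult disj assms(5) dep) auto
  also have "measure_pmf.expectation (Pi_pmf ?U d p) (\<lambda>\<omega>. \<Prod>i\<in>I. g i \<omega>) =
      measure_pmf.expectation (Pi_pmf D d p) (\<lambda>\<omega>. \<Prod>i\<in>I. g i \<omega>)"
    using insert.prems(1) by (intro expectation_Pi_pmf_subset[symmetric] assms(2) dep) auto
  also have "\<dots> = (\<Prod>i\<in>I. measure_pmf.expectation (Pi_pmf (E i) d p) (g i))"
    using insert.prems by (intro insert.IH) (auto simp: disjoint_family_on_def)
  finally show ?case using insert.hyps by simp
qed

section \<open>Crossings of blocks\<close>

definition hedge :: "nat \<Rightarrow> nat \<Rightarrow> edge" where
  "hedge x y = ((int x, int y), (int x + 1, int y))"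

definition vedge :: "nat \<Rightarrow> nat \<Rightarrow> edge" where
  "vedge x y = ((int x, int y), (int x, int y + 1))"

text \<open>The tag is \<open>True\<close> for horizontal edges. Vertical edges in the first and
  last column are left out, so that the index set is invariant under
  \<open>(c, x, y) \<mapsto> (c, y, x)\<close>, the duality map, and consecutive blocks share no
  edge.\<close>

definition block_index :: "nat \<Rightarrow> (bool \<times> nat \<times> nat) set" where
  "block_index k = {(c, x, y). (if c then x < k \<and> y < k else Suc x < k \<and> Suc y < k)}"

definition block_edge :: "nat \<Rightarrow> nat \<Rightarrow> bool \<times> nat \<times> nat \<Rightarrow> edge" where
  "block_edge k j = (\<lambda>(c, x, y). if c then hedge (j * k + x) y else vedge (j * k + Suc x) y)"

definition block :: "nat \<Rightarrow> nat \<Rightarrow> edge set" where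
  "block k j = block_edge k j ` block_index k"

definition block_crossed :: "real \<Rightarrow> nat \<Rightarrow> nat \<Rightarrow> (edge \<Rightarrow> real) \<Rightarrow> bool" where
  "block_crossed a k j \<omega> \<longleftrightarrow>
    crossed (\<lambda>x y. \<omega> (hedge (j * k + x) y) = a) (\<lambda>x y. \<omega> (vedge (j * k + Suc x) y) = a) k"

lemma finite_block_index: "finite (block_index k)"
  by (rule finite_subset[of _ "UNIV \<times> {..<k} \<times> {..<k}"]) (auto simp: block_index_def split: if_splits)

lemma finite_block: "finite (block k j)"
  unfolding block_def by (simp add: finite_block_index)

lemma inj_block_edge: "inj (block_edge k j)"
  by (auto simp: inj_def block_edge_def hedge_def vedge_def split: if_splits)

lemma depends_on_block_crossed: "depends_on (block k j) (block_crossed a k j)"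
proof -
  have "hedge (j * k + x) y \<in> block k j" if "x < k" "y < k" for x y
    unfolding block_def using that
    by (intro image_eqI[of _ _ "(True, x, y)"]) (auto simp: block_edge_def block_index_def)
  moreover have "vedge (j * k + Suc x) y \<in> block k j" if "Suc x < k" "Suc y < k" for x y
    unfolding block_def using that
    by (intro image_eqI[of _ _ "(False, x, y)"]) (auto simp: block_edge_def block_index_def)
  ultimately show ?thesis
    unfolding depends_on_def block_crossed_def by (intro allI impI crossed_cong) auto
qed

text \<open>The map \<open>?T\<close> transposes the square and exchanges \<open>a\<close> with
  \<open>b\<close>. It preserves the uniform measure, and by duality a configuration and its image
  are not both crossed.\<close>

lemma prob_crossed_index_le_half:
  fixes a b :: real
  assumes "a \<noteq> b"
  shows "measure_pmf.prob (Pi_pmf (block_index k) a (\<lambda>_. pmf_of_set {a, b}))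
    {\<xi>. crossed (\<lambda>x y. \<xi> (True, x, y) = a) (\<lambda>x y. \<xi> (False, x, y) = a) k} \<le> 1/2"
    (is "measure_pmf.prob ?M {\<xi>. ?cr \<xi>} \<le> _")
proof -
  let ?s = "\<lambda>v::real. if v = a then b else a"
  let ?t = "\<lambda>(c::bool, x::nat, y::nat). (c, y, x)"
  let ?T = "\<lambda>\<xi>. ?s \<circ> (\<xi> \<circ> ?t)"
  have dep: "depends_on (block_index k) (\<lambda>\<xi>. ?cr \<xi>)"
    unfolding depends_on_def by (intro allI impI crossed_cong) (auto simp: block_index_def)
  have "bij_betw ?t (block_index k) (block_index k)"
    by (rule bij_betwI[where g = ?t]) (auto simp: block_index_def)
  then have 1: "?M = map_pmf (\<lambda>g. g \<circ> ?t) ?M"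
    by (intro Pi_pmf_bij_betw finite_block_index) (auto simp: block_index_def split: if_splits)
  have "map_pmf ?s (pmf_of_set {a, b}) = pmf_of_set (?s ` {a, b})"
    using assms by (intro map_pmf_of_set_inj) (auto simp: inj_on_def)
  also have "?s ` {a, b} = {a, b}" using assms by auto
  finally have 2: "map_pmf ?s (pmf_of_set {a, b}) = pmf_of_set {a, b}" .
  \<comment> \<open>Exchanging the weights also turns the default \<open>a\<close> outside the index
    set into \<open>b\<close>. The default is restored afterwards, which the crossing event does not
    notice.\<close>
  have "Pi_pmf (block_index k) b (\<lambda>_. pmf_of_set {a, b}) =
      Pi_pmf (block_index k) b (\<lambda>_. map_pmf ?s (pmf_of_set {a, b}))"
    by (simp only: 2)
  also have "\<dots> = map_pmf (\<lambda>h. ?s \<circ> h) ?M"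
    by (intro Pi_pmf_map finite_block_index) simp
  also have "\<dots> = map_pmf ?T ?M"
    by (subst 1) (simp add: map_pmf_comp o_assoc)
  finally have 3: "Pi_pmf (block_index k) b (\<lambda>_. pmf_of_set {a, b}) = map_pmf ?T ?M" .
  have "?M = map_pmf (\<lambda>f x. if x \<in> block_index k then f x else a)
      (Pi_pmf (block_index k) b (\<lambda>_. pmf_of_set {a, b}))"
    by (intro Pi_pmf_default_swap[symmetric] finite_block_index)
  then have "measure_pmf.prob ?M {\<xi>. ?cr \<xi>} = measure_pmf.prob (map_pmf (\<lambda>f x. if x \<in> block_index k then f x else a)
      (Pi_pmf (block_index k) b (\<lambda>_. pmf_of_set {a, b}))) {\<xi>. ?cr \<xi>}"
    by simp
  also have "\<dots> = measure_pmf.prob (Pi_pmf (block_index k) b (\<lambda>_. pmf_of_set {a, b})) {\<xi>. ?cr \<xi>}"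
    unfolding measure_map_pmf vimage_def
    by (intro arg_cong[where f = "measure_pmf.prob _"] Collect_cong)
      (simp only: mem_Collect_eq, intro depends_onD[OF dep], simp)
  also have "\<dots> = measure_pmf.prob ?M {\<xi>. ?cr (?T \<xi>)}"
    unfolding 3 by (simp add: vimage_def)
  finally have eq: "measure_pmf.prob ?M {\<xi>. ?cr \<xi>} = measure_pmf.prob ?M {\<xi>. ?cr (?T \<xi>)}" .
  have "(?s v = a) = (v \<noteq> a)" for v using assms by auto
  then have "{\<xi>. ?cr \<xi>} \<inter> {\<xi>. ?cr (?T \<xi>)} = {}"
    using not_crossed_and_dual_crossed[where k = k] by auto
  then have "measure_pmf.prob ?M {\<xi>. ?cr \<xi>} + measure_pmf.prob ?M {\<xi>. ?cr (?T \<xi>)} =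
      measure_pmf.prob ?M ({\<xi>. ?cr \<xi>} \<union> {\<xi>. ?cr (?T \<xi>)})"
    by (intro measure_pmf.finite_measure_Union[symmetric]) auto
  also have "\<dots> \<le> 1" by simp
  finally show ?thesis using eq by simp
qed

lemma prob_block_crossed_le_half:
  assumes "a \<noteq> b"
  shows "measure_pmf.prob (weight_pmf a b (block k j)) {\<omega>. block_crossed a k j \<omega>} \<le> 1/2"
proof -
  have bij: "bij_betw (block_edge k j) (block_index k) (block k j)"
    using inj_block_edge unfolding block_def bij_betw_def by (auto intro: inj_on_subset)
  have "Pi_pmf (block_index k) a (\<lambda>_. pmf_of_set {a, b}) =
      map_pmf (\<lambda>g. g \<circ> block_edge k j) (weight_pmf a b (block k j))"
    unfolding weight_pmf_def
    by (intro Pi_pmf_bij_betw[OF finite_block_index bij])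
      (auto simp: block_def inj_image_mem_iff[OF inj_block_edge])
  with prob_crossed_index_le_half[OF assms, of k] show ?thesis
    by (simp add: vimage_def block_crossed_def block_edge_def)
qed

lemma weight_pmf_finite: "finite A \<Longrightarrow> finite (set_pmf (weight_pmf a b A))"
  unfolding weight_pmf_def by (intro finite_set_Pi_pmf) simp_all

text \<open>Chernoff bound: each uncrossed block contributes a factor 1/2, and as a block is crossed
  with probability at most 1/2, the factor of one block has mean at most 3/4. Blocks are
  independent, and Markov's inequality with \<open>(6/5) ^ J\<close> gives the rate
  \<open>6/5 * 3/4 = 9/10\<close>.\<close>

lemma prob_few_uncrossed_blocks:
  assumes "a \<noteq> b" and "finite D" and "\<And>j. j < J \<Longrightarrow> block k j \<subseteq> D" and "disjoint_family_on (block k) {..<J}"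
  shows "measure_pmf.prob (weight_pmf a b D) {\<omega>. 8 * card {j. j < J \<and> \<not> block_crossed a k j \<omega>} < J} \<le> (9/10) ^ J"
proof -
  let ?g = "\<lambda>j \<omega>. if block_crossed a k j \<omega> then 1 else 1/2 :: real"
  let ?M = "weight_pmf a b D"
  let ?N = "\<lambda>\<omega>. card {j. j < J \<and> \<not> block_crossed a k j \<omega>}"
  have prod: "(\<Prod>j<J. ?g j \<omega>) = (1/2) ^ ?N \<omega>" for \<omega>
    by (simp add: prod.If_cases lessThan_def Int_def)
  have "measure_pmf.expectation ?M (\<lambda>\<omega>. \<Prod>j<J. ?g j \<omega>) =
      (\<Prod>j<J. measure_pmf.expectation (weight_pmf a b (block k j)) (?g j))"
    unfolding weight_pmf_def
  proof (intro expectation_Pi_pmf_prod assms(2,4))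
    show "depends_on (block k j) (?g j)" for j
      using depends_on_block_crossed[of k j a] unfolding depends_on_def by (metis (mono_tags))
  qed (use assms(3) in auto)
  also have "\<dots> \<le> (\<Prod>j<J. 3/4)"
  proof (intro prod_mono conjI)
    fix j
    let ?B = "weight_pmf a b (block k j)"
    have "measure_pmf.expectation ?B (?g j) =
        measure_pmf.expectation ?B (\<lambda>\<omega>. 1/2 + 1/2 * indicator {\<omega>. block_crossed a k j \<omega>} \<omega>)"
      by (intro Bochner_Integration.integral_cong) (auto simp: indicator_def)
    also have "\<dots> = 1/2 + 1/2 * measure_pmf.prob ?B {\<omega>. block_crossed a k j \<omega>}"
      by (subst Bochner_Integration.integral_add)
        (auto intro!: integrable_measure_pmf_finite weight_pmf_finite finite_block)
    also have "\<dots> \<le> 3/4"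
      using prob_block_crossed_le_half[OF assms(1), of k j] by simp
    finally show "measure_pmf.expectation ?B (?g j) \<le> 3/4" .
  qed (auto intro!: Bochner_Integration.integral_nonneg)
  finally have E: "measure_pmf.expectation ?M (\<lambda>\<omega>. (1/2) ^ ?N \<omega>) \<le> ((3/4) ^ J :: real)"
    unfolding prod by simp
  have "measure_pmf.prob ?M {\<omega>. 8 * ?N \<omega> < J} = measure_pmf.expectation ?M (indicator {\<omega>. 8 * ?N \<omega> < J})"
    by simp
  also have "\<dots> \<le> measure_pmf.expectation ?M (\<lambda>\<omega>. (6/5) ^ J * (1/2) ^ ?N \<omega>)"
  proof (intro integral_mono integrable_measure_pmf_finite weight_pmf_finite assms(2))
    fix \<omega>
    have "1 \<le> (6/5) ^ J * (1/2 :: real) ^ ?N \<omega>" if "8 * ?N \<omega> < J"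
    proof -
      \<comment> \<open>The threshold \<open>J / 8\<close> and the base 6/5 are matched by
        \<open>(6/5) ^ 8 > 2\<close>.\<close>
      have "(1::real) \<le> ((6/5) ^ 8 * (1/2)) ^ ?N \<omega>"
        by (intro one_le_power) (simp add: eval_nat_numeral)
      also have "\<dots> = (6/5) ^ (8 * ?N \<omega>) * (1/2) ^ ?N \<omega>"
        by (simp only: power_mult power_mult_distrib)
      also have "\<dots> \<le> (6/5) ^ J * (1/2) ^ ?N \<omega>"
        using that by (intro mult_right_mono power_increasing) auto
      finally show ?thesis .
    qed
    then show "indicator {\<omega>. 8 * ?N \<omega> < J} \<omega> \<le> (6/5) ^ J * (1/2 :: real) ^ ?N \<omega>"
      by (auto simp: indicator_def)
  qed
  also have "\<dots> = (6/5) ^ J * measure_pmf.expectation ?M (\<lambda>\<omega>. (1/2) ^ ?N \<omega>)"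
    by simp
  also have "\<dots> \<le> (6/5) ^ J * (3/4) ^ J"
    by (intro mult_left_mono E) simp
  also have "\<dots> = (9/10) ^ J"
    by (simp flip: power_mult_distrib)
  finally show ?thesis .
qed

section \<open>Geodesics in a strip\<close>

definition strip :: "nat \<Rightarrow> nat \<Rightarrow> int \<Rightarrow> edge set" where
  "strip n k i = {e \<in> Zedges. fst e \<in> rect n k i \<and> snd e \<in> rect n k i}"

lemma finite_rect: "finite (rect n k i)"
  unfolding rect_def by simp

lemma card_rect: "card (rect n k i) = (n + 1) * k"
  unfolding rect_def by (simp add: card_cartesian_product nat_add_distrib)

lemma finite_strip: "finite (strip n k i)"
  by (rule finite_subset[of _ "rect n k i \<times> rect n k i"]) (auto simp: strip_def finite_rect)

lemma card_strip_le: "card (strip n k i) \<le> 2 * (n + 1) * k"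
proof -
  have "strip n k i \<subseteq> (\<lambda>p. (p, (fst p + 1, snd p))) ` rect n k i \<union> (\<lambda>p. (p, (fst p, snd p + 1))) ` rect n k i"
    by (auto simp: strip_def Zedges_def image_iff)
  then have "card (strip n k i) \<le> card ((\<lambda>p. (p, (fst p + 1, snd p))) ` rect n k i \<union> (\<lambda>p. (p, (fst p, snd p + 1))) ` rect n k i)"
    by (intro card_mono) (simp_all add: finite_rect)
  also have "\<dots> \<le> card (rect n k i) + card (rect n k i)"
    by (intro order_trans[OF card_Un_le] add_mono card_image_le finite_rect)
  finally show ?thesis by (simp add: card_rect)
qed

lemma hedge_in_strip: "x < n \<Longrightarrow> y < k \<Longrightarrow> hedge x y \<in> strip n k 0"
  by (auto simp: strip_def hedge_def Zedges_def rect_def)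

lemma vedge_in_strip: "x \<le> n \<Longrightarrow> Suc y < k \<Longrightarrow> vedge x y \<in> strip n k 0"
  by (auto simp: strip_def vedge_def Zedges_def rect_def)

lemma card_strip_ge:
  assumes "0 < k"
  shows "n \<le> card (strip n k 0)"
proof -
  have "card ((\<lambda>x. hedge x 0) ` {..<n}) \<le> card (strip n k 0)"
    using assms by (intro card_mono finite_strip) (auto intro: hedge_in_strip)
  moreover have "card ((\<lambda>x. hedge x 0) ` {..<n}) = n"
    by (subst card_image) (auto simp: inj_on_def hedge_def)
  ultimately show ?thesis by simp
qed

lemma block_subset_strip:
  assumes "j < n div k"
  shows "block k j \<subseteq> strip n k 0"
proof -
  have "Suc j * k \<le> n div k * k" using assms by (intro mult_le_mono1) simp
  also have "\<dots> \<le> n" by (rule div_times_less_eq_dividend)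
  finally have "j * k + k \<le> n" by simp
  then show ?thesis
    by (auto simp: block_def block_edge_def block_index_def split: if_splits
        intro!: hedge_in_strip vedge_in_strip)
qed

text \<open>Besides the disjointness of the blocks, this provides the map from edges to blocks by
  which \<open>b\<close>-edges of a geodesic are counted.\<close>

lemma block_column:
  assumes "e \<in> block k j"
  shows "nat (fst (fst e)) div k = j"
proof -
  obtain c x y where "(c, x, y) \<in> block_index k" "e = block_edge k j (c, x, y)"
    using assms unfolding block_def by auto
  then have "(if c then x else Suc x) < k" "fst (fst e) = int (j * k + (if c then x else Suc x))"
    by (auto simp: block_index_def block_edge_def hedge_def vedge_def)
  then obtain x where "x < k" and e: "fst (fst e) = int (j * k + x)"
    by blast
  then have "nat (fst (fst e)) = j * k + x" by (simp only: e nat_int)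
  with \<open>x < k\<close> have "nat (fst (fst e)) div k = j" by simp
  then show ?thesis by simp
qed

lemma disjoint_blocks: "disjoint_family_on (block k) J"
  unfolding disjoint_family_on_def using block_column by blast

section \<open>Crossing paths and existence of geodesics\<close>

lemma adj_cases:
  assumes "adj p q"
  obtains "q = (fst p + 1, snd p)" | "q = (fst p - 1, snd p)" | "q = (fst p, snd p + 1)" | "q = (fst p, snd p - 1)"
  using assms unfolding adj_def by (cases p; cases q) (auto; linarith)

lemma canon_edge_simps:
  "canon_edge (x, y) (x + 1, y) = ((x, y), (x + 1, y))"
  "canon_edge (x, y) (x - 1, y) = ((x - 1, y), (x, y))"
  "canon_edge (x, y) (x, y + 1) = ((x, y), (x, y + 1))"
  "canon_edge (x, y) (x, y - 1) = ((x, y - 1), (x, y))"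
  by (auto simp: canon_edge_def)

lemma crossing_pathsD:
  assumes "xs \<in> crossing_paths n k i"
  shows "xs \<noteq> []" "fst (xs ! 0) = 0" "fst (xs ! (length xs - 1)) = int n"
    and "j < length xs \<Longrightarrow> xs ! j \<in> rect n k i"
    and "Suc j < length xs \<Longrightarrow> adj (xs ! j) (xs ! Suc j)"
proof -
  from assms have *: "xs \<noteq> []" "\<And>j. Suc j < length xs \<Longrightarrow> adj (xs ! j) (xs ! Suc j)"
    "set xs \<subseteq> rect n k i" "fst (hd xs) = 0" "fst (last xs) = int n"
    unfolding crossing_paths_def nn_path_def by blast+
  then show "xs \<noteq> []" "fst (xs ! 0) = 0" "fst (xs ! (length xs - 1)) = int n"
    using hd_conv_nth[of xs] last_conv_nth[of xs] by simp_all
  show "xs ! j \<in> rect n k i" if "j < length xs"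
    using *(3) nth_mem[OF that] by (rule subsetD)
  show "adj (xs ! j) (xs ! Suc j)" if "Suc j < length xs"
    using that by (rule *)
qed

lemma path_edges_subset_strip:
  assumes "xs \<in> crossing_paths n k i"
  shows "path_edges xs \<subseteq> strip n k i"
proof
  fix e assume "e \<in> path_edges xs"
  then obtain j where j: "Suc j < length xs" "e = canon_edge (xs ! j) (xs ! Suc j)"
    unfolding path_edges_def by blast
  obtain u v where p: "xs ! j = (u, v)" by fastforce
  have "adj (xs ! j) (xs ! Suc j)" and "xs ! j \<in> rect n k i" "xs ! Suc j \<in> rect n k i"
    using crossing_pathsD[OF assms] j(1) by simp_all
  then show "e \<in> strip n k i"
    by (cases rule: adj_cases) (auto simp: j(2) p canon_edge_simps strip_def Zedges_def)
qed

lemma crossing_paths_nonempty: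
  assumes "0 < k"
  shows "crossing_paths n k i \<noteq> {}"
proof -
  have "map (\<lambda>x. (int x, i)) [0..<Suc n] \<in> crossing_paths n k i"
    using assms
    by (auto simp: crossing_paths_def nn_path_def adj_def rect_def hd_map last_map nth_append simp del: upt_Suc)
  then show ?thesis by blast
qed

text \<open>There are infinitely many paths, but a passage time depends only on the set of edges
  used, a subset of the finite strip. Hence the infimum is attained.\<close>

lemma finite_passage_times: "finite (passage_time \<omega> ` crossing_paths n k i)"
proof (rule finite_subset)
  show "passage_time \<omega> ` crossing_paths n k i \<subseteq> sum \<omega> ` Pow (strip n k i)"
    using path_edges_subset_strip unfolding passage_time_def by blast
qed (simp add: finite_strip)

lemma crossing_time_le:
  assumes "xs \<in> crossing_paths n k i"
  shows "crossing_time \<omega> n k i \<le> passage_time \<omega> xs"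
  using assms finite_passage_times unfolding crossing_time_def
  by (intro cInf_lower bdd_below_finite) auto

lemma geodesic_exists:
  assumes "0 < k"
  obtains xs where "xs \<in> crossing_paths n k i" "crossing_time \<omega> n k i = passage_time \<omega> xs"
proof -
  have "Inf (passage_time \<omega> ` crossing_paths n k i) \<in> passage_time \<omega> ` crossing_paths n k i"
    using finite_passage_times crossing_paths_nonempty[OF assms]
    by (subst cInf_eq_Min) (auto intro!: Min_in)
  then show ?thesis using that unfolding crossing_time_def by blast
qed

lemma depends_on_crossing_time: "depends_on (strip n k i) (\<lambda>\<omega>. crossing_time \<omega> n k i)"
proof -
  have "passage_time \<omega> xs = passage_time \<omega>' xs"
    if "\<forall>e\<in>strip n k i. \<omega> e = \<omega>' e" "xs \<in> crossing_paths n k i" for \<omega> \<omega>' :: "edge \<Rightarrow> real" and xs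
    unfolding passage_time_def using that path_edges_subset_strip[OF that(2)] by (intro sum.cong) blast+
  then show ?thesis
    unfolding depends_on_def crossing_time_def by (metis (no_types, lifting) image_cong)
qed

lemma crossing_time_mono:
  assumes "0 < k" and "\<And>e. \<omega> e \<le> \<omega>' e"
  shows "crossing_time \<omega> n k i \<le> crossing_time \<omega>' n k i"
proof -
  obtain xs where xs: "xs \<in> crossing_paths n k i" "crossing_time \<omega>' n k i = passage_time \<omega>' xs"
    using geodesic_exists[OF assms(1)] .
  have "crossing_time \<omega> n k i \<le> passage_time \<omega> xs" by (rule crossing_time_le[OF xs(1)])
  also have "\<dots> \<le> passage_time \<omega>' xs"
    unfolding passage_time_def by (intro sum_mono assms(2))
  finally show ?thesis using xs(2) by simp
qed

text \<open>Follows the path from its start in column 0. From the left it enters the block only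
  through column \<open>j * k\<close>, and as long as its edges in the block have weight
  \<open>a\<close> it stays within the reached vertices, which do not include the far
  column.\<close>

lemma path_in_block_reaches:
  assumes xs: "xs \<in> crossing_paths n k 0" and "\<not> block_crossed a k j \<omega>"
    and open_edges: "\<And>e. e \<in> path_edges xs \<inter> block k j \<Longrightarrow> \<omega> e = a" and "i < length xs"
  shows "fst (xs ! i) \<le> int (j * k) \<or>
    (\<exists>x y. xs ! i = (int (j * k + x), int y) \<and>
      reach (\<lambda>x y. \<omega> (hedge (j * k + x) y) = a) (\<lambda>x y. \<omega> (vedge (j * k + Suc x) y) = a) k x y)"
    (is "_ \<or> (\<exists>x y. _ \<and> ?R x y)")
  using \<open>i < length xs\<close>
proof (induction i)
  case 0
  have "fst (xs ! 0) = 0"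
    by (rule crossing_pathsD[OF xs])
  then show ?case by simp
next
  case (Suc i)
  let ?p = "xs ! i" and ?q = "xs ! Suc i"
  have not_k: "\<not> ?R k y" for y
    using assms(2) unfolding block_crossed_def crossed_def by blast
  have adj: "adj ?p ?q" and rect: "?p \<in> rect n k 0" "?q \<in> rect n k 0"
    using crossing_pathsD[OF xs] Suc.prems by simp_all
  have edge: "canon_edge ?p ?q \<in> path_edges xs"
    using Suc.prems unfolding path_edges_def by blast
  have hor: "\<omega> (hedge (j * k + x) y) = a" if "canon_edge ?p ?q = hedge (j * k + x) y" "x < k" "y < k" for x y
  proof -
    have "hedge (j * k + x) y \<in> block k j"
      unfolding block_def using that
      by (intro image_eqI[of _ _ "(True, x, y)"]) (auto simp: block_edge_def block_index_def)
    then show ?thesis using open_edges edge that(1) by auto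
  qed
  have ver: "\<omega> (vedge (j * k + Suc x) y) = a"
    if "canon_edge ?p ?q = vedge (j * k + Suc x) y" "Suc x < k" "Suc y < k" for x y
  proof -
    have "vedge (j * k + Suc x) y \<in> block k j"
      unfolding block_def using that
      by (intro image_eqI[of _ _ "(False, x, y)"]) (auto simp: block_edge_def block_index_def)
    then show ?thesis using open_edges edge that(1) by auto
  qed
  show ?case
  proof (cases "fst ?q \<le> int (j * k)")
    case False
    have "\<exists>x y. ?p = (int (j * k + x), int y) \<and> ?R x y"
    proof (cases "fst ?p \<le> int (j * k)")
      \<comment> \<open>A single step that passes beyond column \<open>j * k\<close> starts in that
        column, where every row is reached by \<open>reach.left\<close>.\<close>
      case True
      define y where "y = nat (snd ?p)"
      have "?p = (int (j * k + 0), int y)" "y < k"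
        using adj True False rect(1) unfolding y_def
        by (auto elim!: adj_cases simp: rect_def prod_eq_iff)
      then show ?thesis using reach.left by blast
    next
      case False
      then show ?thesis using Suc by auto
    qed
    then obtain x y where p: "?p = (int (j * k + x), int y)" and R: "?R x y" by blast
    have "x \<le> k" "y < k" using reach_bounds[OF R] by auto
    \<comment> \<open>As the block is uncrossed, its far column is not reached, so the next step
      again uses an edge of the block.\<close>
    with R not_k have x: "x < k" by (cases "x = k") auto
    from adj show ?thesis
    proof (cases rule: adj_cases)
      case 1
      then have q: "?q = (int (j * k + Suc x), int y)" using p by simp
      have "canon_edge ?p ?q = hedge (j * k + x) y"
        unfolding p q hedge_def by (simp add: canon_edge_def)
      then have "?R (Suc x) y" by (intro reach.hor[OF R x] hor x \<open>y < k\<close>)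
      then show ?thesis using q by blast
    next
      case 2
      then obtain x' where x': "x = Suc x'" using False p by (cases x) auto
      then have q: "?q = (int (j * k + x'), int y)" using p 2 by simp
      have "canon_edge ?p ?q = hedge (j * k + x') y"
        unfolding p q hedge_def by (simp add: canon_edge_def x')
      then have "?R x' y" using x x' by (intro reach.hor_back[OF R[unfolded x']] hor \<open>y < k\<close>) auto
      then show ?thesis using q by blast
    next
      case 3
      then obtain x' where x': "x = Suc x'" using False p by (cases x) auto
      have q: "?q = (int (j * k + Suc x'), int (Suc y))" using p 3 x' by simp
      then have "Suc y < k" using rect(2) by (simp add: rect_def)
      have "canon_edge ?p ?q = vedge (j * k + Suc x') y"
        unfolding p q vedge_def by (simp add: canon_edge_def x')
      then have "?R (Suc x') (Suc y)"
        using x x' by (intro reach.ver[OF R[unfolded x']] ver \<open>Suc y < k\<close>) auto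
      then show ?thesis using q by blast
    next
      case 4
      then obtain x' where x': "x = Suc x'" using False p by (cases x) auto
      obtain y' where y': "y = Suc y'" using 4 p rect(2) by (cases y) (auto simp: rect_def)
      have q: "?q = (int (j * k + Suc x'), int y')" using p 4 x' y' by simp
      have "canon_edge ?p ?q = vedge (j * k + Suc x') y'"
        unfolding p q vedge_def by (simp add: canon_edge_def x' y')
      then have "?R (Suc x') y'"
        using x x' y' \<open>y < k\<close> by (intro reach.ver_back[OF R[unfolded x' y']] ver) auto
      then show ?thesis using q by blast
    qed
  qed simp
qed

text \<open>The path ends in column \<open>n\<close>, at or beyond the far column
  \<open>j * k + k\<close> of the block. If its edges in the block were all of weight
  \<open>a\<close>, its endpoint would be a reached vertex of that column.\<close>

lemma crossing_path_meets_uncrossed_block: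
  assumes xs: "xs \<in> crossing_paths n k 0" and "\<not> block_crossed a k j \<omega>" and "j < n div k"
  shows "\<exists>e \<in> path_edges xs \<inter> block k j. \<omega> e \<noteq> a"
proof (rule ccontr)
  assume "\<not> ?thesis"
  then have open_edges: "\<omega> e = a" if "e \<in> path_edges xs \<inter> block k j" for e
    using that by blast
  let ?i = "length xs - 1"
  have "?i < length xs" and last: "fst (xs ! ?i) = int n"
    using crossing_pathsD(1,3)[OF xs] by simp_all
  have "0 < k" using assms(3) by (cases k) auto
  have "Suc j * k \<le> n div k * k" using assms(3) by (intro mult_le_mono1) simp
  also have "\<dots> \<le> n" by (rule div_times_less_eq_dividend)
  finally have jk: "j * k + k \<le> n" by simp
  have "\<not> fst (xs ! ?i) \<le> int (j * k)"
    using last jk \<open>0 < k\<close> by linarith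
  with path_in_block_reaches[OF xs assms(2) open_edges \<open>?i < length xs\<close>]
  obtain x y where "xs ! ?i = (int (j * k + x), int y)"
    and R: "reach (\<lambda>x y. \<omega> (hedge (j * k + x) y) = a) (\<lambda>x y. \<omega> (vedge (j * k + Suc x) y) = a) k x y"
    by blast
  then have "int n = int (j * k + x)" using last by simp
  then have "n = j * k + x" by (simp only: of_nat_eq_iff)
  moreover have "x \<le> k" using reach_bounds[OF R] by blast
  ultimately have "x = k" using jk by linarith
  with R assms(2) show False
    unfolding block_crossed_def crossed_def by blast
qed

text \<open>Distinct uncrossed blocks yield distinct edges, since the column of an edge determines
  its block.\<close>

lemma card_uncrossed_le:
  assumes xs: "xs \<in> crossing_paths n k 0"
  shows "card {j. j < n div k \<and> \<not> block_crossed a k j \<omega>} \<le> card {e \<in> path_edges xs. \<omega> e \<noteq> a}"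
proof (rule surj_card_le)
  show "finite {e \<in> path_edges xs. \<omega> e \<noteq> a}"
    using path_edges_subset_strip[OF xs] finite_strip finite_subset by fastforce
  show "{j. j < n div k \<and> \<not> block_crossed a k j \<omega>} \<subseteq> (\<lambda>e. nat (fst (fst e)) div k) ` {e \<in> path_edges xs. \<omega> e \<noteq> a}"
  proof
    fix j assume "j \<in> {j. j < n div k \<and> \<not> block_crossed a k j \<omega>}"
    then obtain e where "e \<in> path_edges xs" "e \<in> block k j" "\<omega> e \<noteq> a"
      using crossing_path_meets_uncrossed_block[OF xs] by blast
    then show "j \<in> (\<lambda>e. nat (fst (fst e)) div k) ` {e \<in> path_edges xs. \<omega> e \<noteq> a}"
      using block_column by fastforce
  qed
qed

section \<open>Configurations as sets of \<open>b\<close>-edges\<close>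

definition conf :: "real \<Rightarrow> real \<Rightarrow> edge set \<Rightarrow> edge \<Rightarrow> real" where
  "conf a b B = (\<lambda>e. if e \<in> B then b else a)"

lemma weight_pmf_conv_Pow:
  assumes "a \<noteq> b" and "finite S"
  shows "weight_pmf a b S = map_pmf (conf a b) (pmf_of_set (Pow S))"
proof -
  have "bij_betw (conf a b) (Pow S) (PiE_dflt S a (\<lambda>_. {a, b}))"
    by (rule bij_betwI[where g = "\<lambda>\<omega>. {e \<in> S. \<omega> e = b}"])
      (use assms(1) in \<open>force simp: conf_def PiE_dflt_def\<close>)+
  then show ?thesis
    unfolding weight_pmf_def using assms
    by (subst Pi_pmf_of_set) (auto intro!: map_pmf_of_set_bij_betw[symmetric])
qed

text \<open>Lowering a \<open>b\<close>-edge of a geodesic lowers the crossing time, and a geodesic has a \<open>b\<close>-edge in every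
  block without an \<open>a\<close>-crossing.\<close>
lemma many_decreasing_flips:
  assumes "a < b" and "0 < k" and "B \<subseteq> strip n k 0"
  shows "card {j. j < n div k \<and> \<not> block_crossed a k j (conf a b B)} \<le>
    card {e \<in> B. crossing_time (conf a b (B - {e})) n k 0 < crossing_time (conf a b B) n k 0}"
proof -
  let ?\<omega> = "conf a b B"
  obtain xs where xs: "xs \<in> crossing_paths n k 0" "crossing_time ?\<omega> n k 0 = passage_time ?\<omega> xs"
    using geodesic_exists[OF assms(2)] .
  have fin: "finite (path_edges xs)" "finite B"
    using path_edges_subset_strip[OF xs(1)] assms(3) finite_strip finite_subset by blast+
  have "crossing_time (conf a b (B - {e})) n k 0 < crossing_time ?\<omega> n k 0"
    if e: "e \<in> path_edges xs" "e \<in> B" for e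
  proof -
    have "crossing_time (conf a b (B - {e})) n k 0 \<le> passage_time (conf a b (B - {e})) xs"
      by (rule crossing_time_le[OF xs(1)])
    also have "\<dots> < passage_time ?\<omega> xs"
      unfolding passage_time_def using fin(1) e assms(1)
      by (intro sum_strict_mono_ex1) (auto simp: conf_def)
    finally show ?thesis using xs(2) by simp
  qed
  moreover have "{e \<in> path_edges xs. ?\<omega> e \<noteq> a} \<subseteq> path_edges xs \<inter> B"
    by (auto simp: conf_def)
  ultimately have "card {e \<in> path_edges xs. ?\<omega> e \<noteq> a} \<le>
      card {e \<in> B. crossing_time (conf a b (B - {e})) n k 0 < crossing_time ?\<omega> n k 0}"
    using fin by (intro card_mono) auto
  with card_uncrossed_le[OF xs(1), of a ?\<omega>] show ?thesis by simp
qed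

section \<open>Atoms of monotone functions on the cube\<close>

lemma choose_mult_pred:
  assumes "1 \<le> t" and "t \<le> N"
  shows "real (N choose t) * real t = real (N choose (t - 1)) * (real N - real t + 1)"
proof -
  obtain m where m: "t = Suc m" using assms(1) by (cases t) auto
  have "(N choose m) * (N - m) = (N choose Suc m) * Suc m"
    using binomial_absorb_comp[of N m] binomial_absorption[of m N] by (simp only: mult.commute)
  then have "real (N choose m) * real (N - m) = real (N choose Suc m) * real (Suc m)"
    by (simp only: of_nat_mult[symmetric])
  then show ?thesis using assms by (simp add: m of_nat_diff)
qed

text \<open>The quotient of the coefficients at \<open>t - 1\<close> and \<open>t\<close> is
  \<open>t / (N - t + 1)\<close>. It is at least \<open>1 - 1 / (2 * L)\<close> even up to
  \<open>L\<close> steps below the window, because \<open>16 * L\<^sup>2 \<le> N\<close> bounds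
  these \<open>L\<close> steps by \<open>N / (16 * L)\<close>, the distance of the window from
  \<open>N / 2\<close>.\<close>

lemma binomial_ratio_below:
  fixes L :: nat
  assumes "0 < L" and "16 * L\<^sup>2 \<le> N" and "real N / 2 - real N / (16 * real L) \<le> real s" and "s \<le> N"
    and "i \<le> L" and "i \<le> s"
  shows "(1 - 1 / (2 * real L)) ^ i * real (N choose s) \<le> real (N choose (s - i))"
  using assms(5,6)
proof (induction i)
  case 0
  then show ?case by simp
next
  case (Suc i)
  define t where "t = s - i"
  have t: "0 < t" "t \<le> N" "s - Suc i = t - 1" "real t = real s - real i"
    using Suc.prems assms(4) unfolding t_def by auto
  let ?x = "1 / (2 * real L)" and ?y = "real N - real t + 1"
  have x: "0 < ?x" "?x \<le> 1/2" using assms(1) by (auto simp: field_simps)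
  have NL: "16 * real L * real L \<le> real N"
    using assms(2) by (metis of_nat_le_iff of_nat_mult of_nat_numeral power2_eq_square mult.assoc)
  have y: "(1 - ?x) * ?y \<le> real t"
  proof (cases "2 * real t \<ge> real N + 1")
    case True
    then have "?y \<le> real t" by simp
    moreover have "(1 - ?x) * ?y \<le> 1 * ?y"
      using x t(2) by (intro mult_right_mono) auto
    ultimately show ?thesis by (simp only: mult_1)
  next
    \<comment> \<open>Here \<open>t\<close> falls short of \<open>N / 2\<close> by less than
      \<open>N / (8 * L)\<close>, and the gain \<open>?x * ?y\<close> is at least
      \<open>N / (4 * L)\<close>.\<close>
    case False
    have "real t \<ge> real N / 2 - real N / (16 * real L) - real L + 1"
      using assms(3) Suc.prems(1) t(4) by linarith
    moreover have "?x * ?y \<ge> ?x * (real N / 2)"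
      using False x by (intro mult_left_mono) auto
    moreover have "?x * (real N / 2) = 4 * (real N / (16 * real L))"
      using assms(1) by (simp add: field_simps)
    moreover have "real N / (16 * real L) \<ge> real L"
      using NL assms(1) by (simp add: field_simps)
    ultimately have "2 * real t + ?x * ?y \<ge> real N + 1"
      using assms(1) by linarith
    then show ?thesis by (simp add: left_diff_distrib)
  qed
  have "real (N choose t) * real t = real (N choose (t - 1)) * ?y"
    using t by (intro choose_mult_pred) auto
  moreover have "real (N choose t) * ((1 - ?x) * ?y) \<le> real (N choose t) * real t"
    using y by (intro mult_left_mono) auto
  ultimately have "(real (N choose t) * (1 - ?x)) * ?y \<le> real (N choose (t - 1)) * ?y"
    by (simp add: mult.assoc)
  then have step: "real (N choose t) * (1 - ?x) \<le> real (N choose (t - 1))"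
    using t(2) by (subst (asm) mult_le_cancel_right) auto
  have "(1 - ?x) ^ Suc i * real (N choose s) = (1 - ?x) ^ i * real (N choose s) * (1 - ?x)"
    by simp
  also have "\<dots> \<le> real (N choose t) * (1 - ?x)"
    using Suc x unfolding t_def by (intro mult_right_mono) auto
  also note step
  finally show ?case using t(3) by simp
qed

text \<open>Each of the \<open>L\<close> coefficients just below \<open>s\<close> is at least half
  the one at \<open>s\<close>, since \<open>(1 - 1 / (2 * L)) ^ L \<ge> 1 / 2\<close> by Bernoulli's
  inequality.\<close>

lemma binomial_le_lower_sum:
  fixes L :: nat
  assumes "0 < L" and "16 * L\<^sup>2 \<le> N" and "real N / 2 - real N / (16 * real L) \<le> real s" and "s \<le> N"
  shows "real L / 2 * real (N choose s) \<le> (\<Sum>t<s. real (N choose t))"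
proof -
  let ?x = "1 / (2 * real L)"
  have NL: "16 * real L * real L \<le> real N"
    using assms(2) by (metis of_nat_le_iff of_nat_mult of_nat_numeral power2_eq_square mult.assoc)
  have "real N / (16 * real L) \<le> real N / 16"
    using assms(1) by (intro divide_left_mono) auto
  moreover have "real L * 1 \<le> real L * real L"
    using assms(1) by (intro mult_left_mono) auto
  ultimately have "real L \<le> real s"
    using assms(3) NL by linarith
  then have Ls: "L \<le> s" by simp
  have "1/2 \<le> (1 - ?x) ^ i" if "i \<le> L" for i
  proof -
    have "1/2 \<le> 1 + real i * (- ?x)"
      using that assms(1) by (simp add: field_simps)
    also have "\<dots> \<le> (1 + (- ?x)) ^ i"
      using assms(1) by (intro Bernoulli_inequality) (simp add: field_simps)
    finally show ?thesis by simp
  qed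
  then have "1/2 * real (N choose s) \<le> (1 - ?x) ^ i * real (N choose s)" if "i \<in> {1..L}" for i
    using that by (intro mult_right_mono) auto
  then have "1/2 * real (N choose s) \<le> real (N choose (s - i))" if "i \<in> {1..L}" for i
    using that binomial_ratio_below[OF assms, of i] Ls by (meson atLeastAtMost_iff order_trans)
  then have "(\<Sum>i\<in>{1..L}. 1/2 * real (N choose s)) \<le> (\<Sum>i\<in>{1..L}. real (N choose (s - i)))"
    by (rule sum_mono)
  also have "\<dots> = (\<Sum>t\<in>(\<lambda>i. s - i) ` {1..L}. real (N choose t))"
    using Ls by (subst sum.reindex) (auto simp: inj_on_def)
  also have "\<dots> \<le> (\<Sum>t<s. real (N choose t))"
    using Ls by (intro sum_mono2) auto
  finally show ?thesis by simp
qed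

text \<open>Abel summation, used with \<open>c t\<close> the number of sets of size \<open>t\<close>
  and \<open>u t\<close> the proportion of them with \<open>X < q\<close>.\<close>

lemma sum_by_parts_decreasing:
  fixes c u :: "nat \<Rightarrow> real"
  shows "(\<Sum>s=1..n. (\<Sum>t<s. c t) * (u (s - 1) - u s)) = (\<Sum>t<n. c t * u t) - (\<Sum>t<n. c t) * u n"
  by (induction n) (simp_all add: algebra_simps)

definition drops :: "('e set \<Rightarrow> real) \<Rightarrow> 'e set \<Rightarrow> 'e set" where
  "drops X B = {e \<in> B. X (B - {e}) < X B}"

text \<open>Double counting of the pairs \<open>(B, e)\<close> with \<open>e \<in> B\<close>, \<open>|B| = s\<close> and \<open>X (B - {e}) < q\<close>.\<close>
lemma level_flip_count:
  fixes X :: "'e set \<Rightarrow> real"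
  assumes "finite S" and mono: "\<And>B e. B \<subseteq> S \<Longrightarrow> e \<in> B \<Longrightarrow> X (B - {e}) \<le> X B"
    and "1 \<le> s" and "0 \<le> M"
  shows "M * real (card {B. B \<subseteq> S \<and> card B = s \<and> X B = q \<and> M \<le> real (card (drops X B))})
      + real s * real (card {B. B \<subseteq> S \<and> card B = s \<and> X B < q})
    \<le> real (card S - (s - 1)) * real (card {B. B \<subseteq> S \<and> card B = s - 1 \<and> X B < q})"
    (is "M * real (card ?C) + real s * real (card ?U) \<le> _ * real (card ?V)")
proof -
  have fin: "finite {B. B \<subseteq> S \<and> P B}" for P
    by (rule finite_subset[of _ "Pow S"]) (use assms(1) in auto)
  have finB: "finite B" if "B \<subseteq> S" for B
    using that assms(1) by (rule finite_subset)
  define E where "E B = {e \<in> B. X (B - {e}) < q}" for B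
  have finE: "finite (E B)" if "B \<subseteq> S" for B using finB[OF that] by (simp add: E_def)
  have "M * real (card ?C) = (\<Sum>B\<in>?C. M)" by simp
  also have "\<dots> \<le> (\<Sum>B\<in>?C. real (card (E B)))"
  proof (rule sum_mono)
    fix B assume "B \<in> ?C"
    then have "drops X B = E B" "M \<le> real (card (drops X B))" by (auto simp: E_def drops_def)
    then show "M \<le> real (card (E B))" by simp
  qed
  finally have 1: "M * real (card ?C) \<le> (\<Sum>B\<in>?C. real (card (E B)))" .
  \<comment> \<open>If \<open>X B < q\<close>, then by monotonicity every removal stays below
    \<open>q\<close>, so all \<open>s\<close> elements are counted. On the atom exactly the drops
    are counted.\<close>
  have "real s * real (card ?U) = (\<Sum>B\<in>?U. real s)" by simp
  also have "\<dots> = (\<Sum>B\<in>?U. real (card (E B)))"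
  proof (rule sum.cong)
    fix B assume B: "B \<in> ?U"
    then have "E B = B" using mono[of B] by (auto simp: E_def intro: le_less_trans)
    with B show "real s = real (card (E B))" by simp
  qed simp
  finally have 2: "real s * real (card ?U) = (\<Sum>B\<in>?U. real (card (E B)))" .
  have "(\<Sum>B\<in>?C. real (card (E B))) + (\<Sum>B\<in>?U. real (card (E B))) = (\<Sum>B\<in>?C \<union> ?U. real (card (E B)))"
    by (intro sum.union_disjoint[symmetric] fin) auto
  also have "\<dots> = real (card (Sigma (?C \<union> ?U) E))"
    using fin finE by (subst card_SigmaI) auto
  also have "\<dots> \<le> real (card (Sigma ?V (\<lambda>B. S - B)))"
  proof -
    have "inj_on (\<lambda>(B, e). (B - {e}, e)) (Sigma (?C \<union> ?U) E)"
      by (rule inj_on_inverseI[where g = "\<lambda>(B, e). (insert e B, e)"]) (auto simp: E_def)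
    moreover have "(\<lambda>(B, e). (B - {e}, e)) ` Sigma (?C \<union> ?U) E \<subseteq> Sigma ?V (\<lambda>B. S - B)"
      using finB by (auto simp: E_def card_Diff_singleton)
    moreover have "finite (Sigma ?V (\<lambda>B. S - B))" using fin assms(1) by (intro finite_SigmaI) auto
    ultimately show ?thesis using card_inj_on_le by fastforce
  qed
  also have "card (Sigma ?V (\<lambda>B. S - B)) = (\<Sum>B\<in>?V. card (S - B))"
    using fin assms(1) by (intro card_SigmaI) auto
  also have "\<dots> = (\<Sum>B\<in>?V. card S - (s - 1))"
    using finB by (intro sum.cong refl) (auto simp: card_Diff_subset)
  also have "\<dots> = (card S - (s - 1)) * card ?V" by simp
  finally show ?thesis using 1 2 by simp
qed

text \<open>Sets with few drops and unusually small sets are put aside. On level \<open>s\<close> of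
  the rest, \<open>level_flip_count\<close> bounds the atom by \<open>N / M\<close> times the number
  of all sets of size \<open>s\<close> times the decrease of the proportion \<open>u\<close>.
  Replacing the binomial coefficient by \<open>2 / L\<close> times the sum of all lower ones lets
  the sum over levels collapse to the number of sets with \<open>X < q\<close>.\<close>

lemma atom_count_le:
  fixes X :: "'e set \<Rightarrow> real" and L :: nat
  assumes "finite S" and mono: "\<And>B e. B \<subseteq> S \<Longrightarrow> e \<in> B \<Longrightarrow> X (B - {e}) \<le> X B"
    and "0 < M" and "0 < L" and "16 * L\<^sup>2 \<le> card S"
  defines "N \<equiv> card S"
  shows "real (card {B. B \<subseteq> S \<and> X B = q}) \<le>
      real (card {B. B \<subseteq> S \<and> \<not> M \<le> real (card (drops X B))})
    + real (card {B. B \<subseteq> S \<and> real (card B) \<le> real N / 2 - real N / (16 * real L)})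
    + 2 * real N / (M * real L) * real (card {B. B \<subseteq> S \<and> X B < q})"
proof -
  let ?c = "\<lambda>s. card {B. B \<subseteq> S \<and> card B = s \<and> X B = q \<and> M \<le> real (card (drops X B))}"
  let ?U = "\<lambda>s. card {B. B \<subseteq> S \<and> card B = s \<and> X B < q}"
  define u where "u s = real (?U s) / real (N choose s)" for s
  let ?low = "real N / 2 - real N / (16 * real L)"
  have fin: "finite {B. B \<subseteq> S \<and> P B}" for P
    by (rule finite_subset[of _ "Pow S"]) (use assms(1) in auto)
  have cardN: "card B \<le> N" if "B \<subseteq> S" for B
    unfolding N_def using that assms(1) by (rule card_mono[rotated])
  have "N > 0" using assms(4,5) unfolding N_def by (cases "card S") auto
  have low_pos: "0 \<le> ?low"
  proof -
    have "real N / (16 * real L) \<le> real N / 2"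
      using assms(4) by (intro divide_left_mono) auto
    then show ?thesis by simp
  qed
  have layers: "card {B. B \<subseteq> S \<and> P B} = (\<Sum>s\<le>N. card {B. B \<subseteq> S \<and> card B = s \<and> P B})" for P
  proof -
    have "{B. B \<subseteq> S \<and> P B} = (\<Union>s\<in>{..N}. {B. B \<subseteq> S \<and> card B = s \<and> P B})"
      using cardN by auto
    moreover have "card (\<Union>s\<in>{..N}. {B. B \<subseteq> S \<and> card B = s \<and> P B}) = (\<Sum>s\<le>N. card {B. B \<subseteq> S \<and> card B = s \<and> P B})"
      using fin by (intro card_UN_disjoint) auto
    ultimately show ?thesis by simp
  qed
  have step: "real (?c s) \<le> real N / M * (real (N choose s) * (u (s - 1) - u s))" if s: "1 \<le> s" "s \<le> N" for s
  proof -
    have ab: "real (N choose s) * real s = real (N choose (s - 1)) * real (N - (s - 1))"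
      using s choose_mult_pred[of s N] by (simp add: of_nat_diff)
    have pos: "real (N choose s) > 0" "real (N choose (s - 1)) > 0" "real s > 0"
      using s by auto
    have "real (N - (s - 1)) * real (?U (s - 1)) = real (N - (s - 1)) * real (N choose (s - 1)) * u (s - 1)"
      unfolding u_def using pos by simp
    also have "\<dots> = real s * (real (N choose s) * u (s - 1))"
      using ab by (simp add: mult_ac)
    finally have "M * real (?c s) + real s * (real (N choose s) * u s) \<le> real s * (real (N choose s) * u (s - 1))"
      using level_flip_count[OF assms(1) mono s(1), of M q] assms(3) pos unfolding N_def[symmetric] u_def by simp
    then have *: "M * real (?c s) \<le> real s * (real (N choose s) * (u (s - 1) - u s))"
      by (simp add: algebra_simps)
    moreover have "0 \<le> M * real (?c s)" using assms(3) by simp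
    ultimately have "0 \<le> real (N choose s) * (u (s - 1) - u s)"
      using pos(3) by (smt (verit) mult_pos_neg)
    then have "real s * (real (N choose s) * (u (s - 1) - u s)) \<le> real N * (real (N choose s) * (u (s - 1) - u s))"
      using s by (intro mult_right_mono) auto
    with * have "M * real (?c s) \<le> real N * (real (N choose s) * (u (s - 1) - u s))" by linarith
    then show ?thesis using assms(3) by (simp add: field_simps)
  qed
  \<comment> \<open>The bound \<open>step\<close> itself forces \<open>u\<close> to decrease, its
    left side being nonnegative.\<close>
  have u_dec: "0 \<le> u (s - 1) - u s" if s: "1 \<le> s" "s \<le> N" for s
  proof -
    have "0 \<le> real N / M * real (N choose s) * (u (s - 1) - u s)"
      using step[OF s] by (simp add: mult.assoc)
    moreover have "0 < real N / M * real (N choose s)"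
      using \<open>N > 0\<close> assms(3) s by simp
    ultimately show ?thesis by (smt (verit) mult_pos_neg)
  qed
  have "real (card {B. B \<subseteq> S \<and> X B = q \<and> M \<le> real (card (drops X B)) \<and> ?low < real (card B)})
     \<le> (\<Sum>s\<in>{s. 1 \<le> s \<and> s \<le> N \<and> ?low \<le> real s}. real (?c s))"
  proof -
    have "card {B. B \<subseteq> S \<and> X B = q \<and> M \<le> real (card (drops X B)) \<and> ?low < real (card B)} \<le>
        card (\<Union>s\<in>{s. 1 \<le> s \<and> s \<le> N \<and> ?low \<le> real s}.
          {B. B \<subseteq> S \<and> card B = s \<and> X B = q \<and> M \<le> real (card (drops X B))})"
    proof (intro card_mono finite_UN_I fin)
      show "finite {s. 1 \<le> s \<and> s \<le> N \<and> ?low \<le> real s}" by (rule finite_subset[of _ "{..N}"]) auto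
      show "{B. B \<subseteq> S \<and> X B = q \<and> M \<le> real (card (drops X B)) \<and> ?low < real (card B)} \<subseteq>
        (\<Union>s\<in>{s. 1 \<le> s \<and> s \<le> N \<and> ?low \<le> real s}.
          {B. B \<subseteq> S \<and> card B = s \<and> X B = q \<and> M \<le> real (card (drops X B))})"
      proof
        fix B assume B: "B \<in> {B. B \<subseteq> S \<and> X B = q \<and> M \<le> real (card (drops X B)) \<and> ?low < real (card B)}"
        then have "0 < real (card B)" using low_pos by auto
        with B cardN[of B] show "B \<in> (\<Union>s\<in>{s. 1 \<le> s \<and> s \<le> N \<and> ?low \<le> real s}.
          {B. B \<subseteq> S \<and> card B = s \<and> X B = q \<and> M \<le> real (card (drops X B))})"
          by auto
      qed
    qed
    also have "\<dots> \<le> (\<Sum>s\<in>{s. 1 \<le> s \<and> s \<le> N \<and> ?low \<le> real s}. ?c s)"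
      by (intro card_UN_le) simp
    finally show ?thesis by (simp only: of_nat_sum[symmetric] of_nat_le_iff)
  qed
  also have "\<dots> \<le> (\<Sum>s\<in>{s. 1 \<le> s \<and> s \<le> N \<and> ?low \<le> real s}.
      2 * real N / (M * real L) * ((\<Sum>t<s. real (N choose t)) * (u (s - 1) - u s)))"
  proof (rule sum_mono)
    fix s assume s: "s \<in> {s. 1 \<le> s \<and> s \<le> N \<and> ?low \<le> real s}"
    have "real (?c s) \<le> real N / M * (real (N choose s) * (u (s - 1) - u s))"
      using s step by blast
    also have "\<dots> = 2 * real N / (M * real L) * ((real L / 2 * real (N choose s)) * (u (s - 1) - u s))"
      using assms(4) by simp
    also have "\<dots> \<le> 2 * real N / (M * real L) * ((\<Sum>t<s. real (N choose t)) * (u (s - 1) - u s))"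
      using s u_dec[of s] assms(3-5) binomial_le_lower_sum[of L N s]
      by (intro mult_left_mono mult_right_mono) (auto simp: N_def)
    finally show "real (?c s) \<le> 2 * real N / (M * real L) * ((\<Sum>t<s. real (N choose t)) * (u (s - 1) - u s))" .
  qed
  \<comment> \<open>Levels below the window are added, their terms being nonnegative, so that Abel
    summation applies to the full range.\<close>
  also have "\<dots> \<le> (\<Sum>s\<in>{1..N}.
      2 * real N / (M * real L) * ((\<Sum>t<s. real (N choose t)) * (u (s - 1) - u s)))"
  proof (rule sum_mono2)
    fix s assume "s \<in> {1..N} - {s. 1 \<le> s \<and> s \<le> N \<and> ?low \<le> real s}"
    then have "0 \<le> (\<Sum>t<s. real (N choose t)) * (u (s - 1) - u s)"
      using u_dec[of s] by (intro mult_nonneg_nonneg sum_nonneg) auto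
    moreover have "0 \<le> 2 * real N / (M * real L)" using assms(3) by simp
    ultimately show "0 \<le> 2 * real N / (M * real L) * ((\<Sum>t<s. real (N choose t)) * (u (s - 1) - u s))"
      by (rule mult_nonneg_nonneg[rotated])
  qed auto
  also have "\<dots> = 2 * real N / (M * real L) *
      ((\<Sum>t<N. real (N choose t) * u t) - (\<Sum>t<N. real (N choose t)) * u N)"
    by (simp only: sum_distrib_left[symmetric] sum_by_parts_decreasing)
  also have "\<dots> \<le> 2 * real N / (M * real L) * real (card {B. B \<subseteq> S \<and> X B < q})"
  proof (intro mult_left_mono)
    have "(\<Sum>t<N. real (N choose t) * u t) = (\<Sum>t<N. real (?U t))"
      unfolding u_def by (intro sum.cong) auto
    also have "\<dots> \<le> (\<Sum>t\<le>N. real (?U t))" by (intro sum_mono2) auto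
    also have "\<dots> = real (card {B. B \<subseteq> S \<and> X B < q})"
      using layers[of "\<lambda>B. X B < q"] by simp
    finally show "(\<Sum>t<N. real (N choose t) * u t) - (\<Sum>t<N. real (N choose t)) * u N
        \<le> real (card {B. B \<subseteq> S \<and> X B < q})"
      by (smt (verit, ccfv_SIG) mult_nonneg_nonneg sum_nonneg of_nat_0_le_iff u_def divide_nonneg_nonneg)
  qed (use assms(3) in simp)
  finally have main: "real (card {B. B \<subseteq> S \<and> X B = q \<and> M \<le> real (card (drops X B)) \<and> ?low < real (card B)})
     \<le> 2 * real N / (M * real L) * real (card {B. B \<subseteq> S \<and> X B < q})" .
  have "card {B. B \<subseteq> S \<and> X B = q} \<le>
      card ({B. B \<subseteq> S \<and> \<not> M \<le> real (card (drops X B))} \<union>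
        ({B. B \<subseteq> S \<and> real (card B) \<le> ?low} \<union>
        {B. B \<subseteq> S \<and> X B = q \<and> M \<le> real (card (drops X B)) \<and> ?low < real (card B)}))"
    using fin by (intro card_mono) auto
  also have "\<dots> \<le> card {B. B \<subseteq> S \<and> \<not> M \<le> real (card (drops X B))} +
      (card {B. B \<subseteq> S \<and> real (card B) \<le> ?low} +
       card {B. B \<subseteq> S \<and> X B = q \<and> M \<le> real (card (drops X B)) \<and> ?low < real (card B)})"
    by (intro order_trans[OF card_Un_le] add_left_mono card_Un_le)
  finally show ?thesis using main by linarith
qed

section \<open>From counts to probabilities\<close>

lemma prob_Pow_conv_card:
  assumes "finite S"
  shows "measure_pmf.prob (pmf_of_set (Pow S)) {B. P B} = real (card {B. B \<subseteq> S \<and> P B}) / 2 ^ card S"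
proof -
  have "Pow S \<inter> {B. P B} = {B. B \<subseteq> S \<and> P B}" by auto
  then show ?thesis using assms by (subst measure_pmf_of_set) (auto simp: card_Pow)
qed

text \<open>Hoeffding's inequality, the size of a uniformly random subset being binomial.\<close>

lemma prob_Pow_card_small:
  assumes "finite S" and "S \<noteq> {}" and "0 \<le> t"
  shows "measure_pmf.prob (pmf_of_set (Pow S)) {B. real (card B) \<le> real (card S) / 2 - t} \<le> exp (- 2 * t\<^sup>2 / card S)"
proof -
  interpret binomial_distribution "card S" "1/2" by unfold_locales simp
  have map_card: "map_pmf card (pmf_of_set (Pow S)) = binomial_pmf (card S) (1/2)"
    unfolding pmf_of_set_Pow_conv_bernoulli[OF assms(1), symmetric, where P = False]
    by (subst binomial_pmf_altdef'[OF assms(1) refl, where dflt = False]) (simp_all add: map_pmf_comp)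
  have "measure_pmf.prob (pmf_of_set (Pow S)) {B. real (card B) \<le> real (card S) / 2 - t} =
      measure_pmf.prob (binomial_pmf (card S) (1/2)) {x. real x \<le> real (card S) * (1/2) - t}"
    unfolding map_card[symmetric] by (simp add: vimage_def)
  also have "\<dots> \<le> exp (- 2 * t\<^sup>2 / card S)"
    using assms by (intro prob_le) auto
  finally show ?thesis .
qed

lemma atom_prob_le:
  fixes X :: "'e set \<Rightarrow> real" and L :: nat
  assumes "finite S" and "\<And>B e. B \<subseteq> S \<Longrightarrow> e \<in> B \<Longrightarrow> X (B - {e}) \<le> X B"
    and "0 < M" and "0 < L" and "16 * L\<^sup>2 \<le> card S"
  defines "N \<equiv> card S" and "P \<equiv> measure_pmf.prob (pmf_of_set (Pow S))"
  shows "P {B. X B = q} \<le> P {B. \<not> M \<le> real (card (drops X B))} + exp (- real N / (128 * (real L)\<^sup>2))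
    + 2 * real N / (M * real L) * P {B. X B < q}"
proof -
  let ?t = "real N / (16 * real L)"
  have N: "N \<noteq> 0" using assms(4,5) unfolding N_def by (cases "card S") auto
  then have "S \<noteq> {}" unfolding N_def by auto
  have "P {B. X B = q} \<le> P {B. \<not> M \<le> real (card (drops X B))} + P {B. real (card B) \<le> real N / 2 - ?t}
      + 2 * real N / (M * real L) * P {B. X B < q}"
    using divide_right_mono[OF atom_count_le[OF assms(1-5), of q], of "2 ^ N"]
    unfolding P_def prob_Pow_conv_card[OF assms(1)] N_def by (simp add: add_divide_distrib)
  also have "P {B. real (card B) \<le> real N / 2 - ?t} \<le> exp (- 2 * ?t\<^sup>2 / N)"
    unfolding P_def N_def using \<open>S \<noteq> {}\<close> by (intro prob_Pow_card_small assms(1)) auto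
  also have "- 2 * ?t\<^sup>2 / N = - real N / (128 * (real L)\<^sup>2)"
    using N by (simp add: power2_eq_square field_simps)
  finally show ?thesis by simp
qed

section \<open>Hypercontractivity of the noise\<close>

lemma powr_pair_ge_two:
  fixes s p :: real
  assumes "0 \<le> s" "s < 1" "p \<le> 0"
  shows "2 \<le> (1 + s) powr p + (1 - s) powr p"
proof -
  let ?x = "(1 + s) powr (p/2)" and ?y = "(1 - s) powr (p/2)"
  have "s * s \<le> 1 * 1" using assms by (intro mult_mono) auto
  moreover have "s * s \<noteq> 1" using assms by (smt (verit) mult_left_le)
  ultimately have "0 < (1 + s) * (1 - s)" "(1 + s) * (1 - s) \<le> 1"
    by (auto simp: algebra_simps)
  then have "1 powr (p/2) \<le> ((1 + s) * (1 - s)) powr (p/2)"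
    using assms(3) by (intro powr_mono2') auto
  \<comment> \<open>The product is a power of \<open>1 - s * s \<le> 1\<close> with exponent
    \<open>p / 2 \<le> 0\<close>. The claim then follows from the arithmetic-geometric mean
    inequality.\<close>
  then have "1 \<le> ?x * ?y"
    using assms by (simp add: powr_mult)
  moreover have "0 \<le> (?x - ?y)\<^sup>2" by simp
  moreover have "?x\<^sup>2 = (1 + s) powr p" "?y\<^sup>2 = (1 - s) powr p"
    using assms by (simp_all add: power2_eq_square powr_add[symmetric])
  ultimately show ?thesis by (simp add: power2_diff)
qed

lemma powr_pair_ge_quadratic:
  fixes s r :: real
  assumes "0 \<le> s" "s \<le> 1" "1 < r" "r < 2"
  shows "2 + r * (r - 1) * s\<^sup>2 \<le> (1 + s) powr r + (1 - s) powr r"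
proof -
  \<comment> \<open>The difference of the two sides is convex in \<open>s\<close>:
    \<open>r * g\<close> is the derivative of \<open>h\<close>, and the derivative of
    \<open>g\<close> is nonnegative by \<open>powr_pair_ge_two\<close>.\<close>
  define g where "g x = (1 + x) powr (r - 1) - (1 - x) powr (r - 1) - 2 * (r - 1) * x" for x :: real
  define h where "h x = (1 + x) powr r + (1 - x) powr r - r * (r - 1) * x\<^sup>2" for x :: real
  have g_nonneg: "0 \<le> g x" if x: "0 \<le> x" "x < 1" for x
  proof -
    have "g 0 \<le> g x"
    proof (rule DERIV_nonneg_imp_nondecreasing[OF x(1)])
      fix y assume y: "0 \<le> y" "y \<le> x"
      have "(g has_real_derivative (r - 1) * ((1 + y) powr (r - 2) + (1 - y) powr (r - 2) - 2)) (at y)"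
        unfolding g_def using y x by (auto intro!: derivative_eq_intros simp: algebra_simps)
      moreover have "0 \<le> (r - 1) * ((1 + y) powr (r - 2) + (1 - y) powr (r - 2) - 2)"
        using powr_pair_ge_two[of y "r - 2"] y x assms by (intro mult_nonneg_nonneg) auto
      ultimately show "\<exists>d. (g has_real_derivative d) (at y) \<and> 0 \<le> d" by blast
    qed
    then show ?thesis by (simp add: g_def)
  qed
  have "h 0 \<le> h s"
  \<comment> \<open>At \<open>s = 1\<close> the base \<open>1 - s\<close> vanishes, so derivatives
    are taken in the open interval only and the endpoint is reached by continuity.\<close>
  proof (rule DERIV_nonneg_imp_increasing_open[OF assms(1)])
    fix y assume y: "0 < y" "y < s"
    have "(h has_real_derivative r * g y) (at y)"
      unfolding h_def g_def using y assms by (auto intro!: derivative_eq_intros simp: algebra_simps)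
    moreover have "0 \<le> r * g y" using g_nonneg[of y] y assms by auto
    ultimately show "\<exists>d. (h has_real_derivative d) (at y) \<and> 0 \<le> d" by blast
  next
    show "continuous_on {0..s} h"
      unfolding h_def using assms by (intro continuous_intros continuous_on_powr') auto
  qed
  then show ?thesis by (simp add: h_def)
qed

text \<open>The Bonami-Beckner inequality for the function on two points with values
  \<open>u\<close> and \<open>v\<close>: its mean is \<open>(u + v) / 2\<close>, and the noise
  multiplies the square of its other Fourier coefficient \<open>(u - v) / 2\<close> by
  \<open>\<rho>\<close>. After division by the mean it follows from the quadratic bound
  above.\<close>

lemma two_point_norm:
  fixes u v r \<rho> :: real
  assumes "0 \<le> u" "0 \<le> v" "1 < r" "r < 2" "0 \<le> \<rho>" "\<rho> \<le> r - 1"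
  shows "((u + v) / 2)\<^sup>2 + \<rho> * ((u - v) / 2)\<^sup>2 \<le> ((u powr r + v powr r) / 2) powr (2 / r)"
proof (cases "u + v = 0")
  case True
  then have "u = 0" "v = 0" using assms by auto
  then show ?thesis by simp
next
  case False
  define m where "m = (u + v) / 2"
  define s where "s = \<bar>u - v\<bar> / (u + v)"
  have pos: "0 < m" "0 < u + v" using False assms by (auto simp: m_def)
  have s: "0 \<le> s" "s \<le> 1" using assms pos by (auto simp: s_def divide_le_eq)
  have "(u + v) * s = \<bar>u - v\<bar>" using pos(2) by (simp add: s_def)
  then have ms: "m * s = \<bar>u - v\<bar> / 2" by (simp add: m_def)
  have eq: "m powr r * ((1 + s) powr r + (1 - s) powr r) = u powr r + v powr r"
  proof -
    have "m powr r * ((1 + s) powr r + (1 - s) powr r) = (m * (1 + s)) powr r + (m * (1 - s)) powr r"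
    proof -
      have "(m * (1 + s)) powr r = m powr r * (1 + s) powr r" "(m * (1 - s)) powr r = m powr r * (1 - s) powr r"
        using pos s by (simp_all add: powr_mult del: distrib_left right_diff_distrib)
      then show ?thesis by (simp only: distrib_left)
    qed
    also have "\<dots> = u powr r + v powr r"
    proof (cases "u \<le> v")
      case True
      then have "m * (1 + s) = v" "m * (1 - s) = u"
        unfolding distrib_left right_diff_distrib ms by (simp_all add: m_def field_simps)
      then show ?thesis by simp
    next
      case False
      then have "m * (1 + s) = u" "m * (1 - s) = v"
        unfolding distrib_left right_diff_distrib ms by (simp_all add: m_def field_simps)
      then show ?thesis by simp
    qed
    finally show ?thesis .
  qed
  \<comment> \<open>Concavity of the power \<open>r / 2 < 1\<close>, in the form of Young's
    inequality: \<open>(1 + z) powr (r / 2) \<le> 1 + r / 2 * z\<close>.\<close>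
  have "(1 + \<rho> * s\<^sup>2) powr (r / 2) * 1 powr (1 - r / 2) \<le> r / 2 * (1 + \<rho> * s\<^sup>2) + (1 - r / 2) * 1"
    using assms by (intro Youngs_inequality_0) (auto intro: add_pos_nonneg)
  then have "(1 + \<rho> * s\<^sup>2) powr (r / 2) \<le> 1 + r / 2 * \<rho> * s\<^sup>2"
    by (simp add: algebra_simps)
  also have "\<dots> \<le> 1 + r / 2 * (r - 1) * s\<^sup>2"
    using assms by (intro add_left_mono mult_right_mono mult_left_mono) auto
  also have "\<dots> = (2 + r * (r - 1) * s\<^sup>2) / 2" by (simp add: field_simps)
  also have "\<dots> \<le> ((1 + s) powr r + (1 - s) powr r) / 2"
    using powr_pair_ge_quadratic[OF s assms(3,4)] by simp
  finally have key: "(1 + \<rho> * s\<^sup>2) powr (r / 2) \<le> ((1 + s) powr r + (1 - s) powr r) / 2" .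
  have base: "0 < 1 + \<rho> * s\<^sup>2" using assms by (intro add_pos_nonneg) auto
  have "((u + v) / 2)\<^sup>2 + \<rho> * ((u - v) / 2)\<^sup>2 = m\<^sup>2 + \<rho> * (m * s)\<^sup>2"
    unfolding ms by (simp add: m_def power_divide)
  also have "\<dots> = m\<^sup>2 * (1 + \<rho> * s\<^sup>2)" by (simp add: algebra_simps power_mult_distrib)
  also have "\<dots> = (m powr r * (1 + \<rho> * s\<^sup>2) powr (r / 2)) powr (2 / r)"
    using pos base assms by (simp add: powr_mult powr_powr)
  also have "\<dots> \<le> (m powr r * (((1 + s) powr r + (1 - s) powr r) / 2)) powr (2 / r)"
    using key assms by (intro powr_mono2 mult_left_mono) auto
  also have "m powr r * (((1 + s) powr r + (1 - s) powr r) / 2) = (u powr r + v powr r) / 2"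
    using eq by simp
  finally show ?thesis .
qed

lemma square_identity:
  fixes p q t w \<rho> :: real
  shows "(p\<^sup>2 + \<rho> * q\<^sup>2) * (t\<^sup>2 + \<rho> * w\<^sup>2) - (p * t + \<rho> * (q * w))\<^sup>2 = \<rho> * (p * w - q * t)\<^sup>2"
  by (simp add: power2_eq_square algebra_simps)

text \<open>In Fourier coefficients the left side is \<open>?a * ?c + \<rho> * (?b * ?d)\<close>, a
  positive semidefinite bilinear form. Cauchy-Schwarz for it, by \<open>square_identity\<close>,
  separates the two functions, and \<open>two_point_norm\<close> bounds each factor.\<close>

lemma two_point_hypercontractive:
  fixes u v x y r \<rho> :: real
  assumes "0 \<le> u" "0 \<le> v" "0 \<le> x" "0 \<le> y" "1 < r" "r < 2" "0 \<le> \<rho>" "\<rho> \<le> r - 1"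
  shows "(1 + \<rho>) / 4 * (u * x + v * y) + (1 - \<rho>) / 4 * (u * y + v * x)
    \<le> ((u powr r + v powr r) / 2) powr (1 / r) * ((x powr r + y powr r) / 2) powr (1 / r)"
proof -
  let ?a = "(u + v) / 2" and ?b = "(u - v) / 2" and ?c = "(x + y) / 2" and ?d = "(x - y) / 2"
  let ?P = "(u powr r + v powr r) / 2" and ?Q = "(x powr r + y powr r) / 2"
  have "(1 + \<rho>) / 4 * (u * x + v * y) + (1 - \<rho>) / 4 * (u * y + v * x) = ?a * ?c + \<rho> * (?b * ?d)"
    by (simp add: field_simps)
  also have "\<dots> \<le> sqrt ((?a\<^sup>2 + \<rho> * ?b\<^sup>2) * (?c\<^sup>2 + \<rho> * ?d\<^sup>2))"
  proof (rule real_le_rsqrt)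
    have "(?a\<^sup>2 + \<rho> * ?b\<^sup>2) * (?c\<^sup>2 + \<rho> * ?d\<^sup>2) - (?a * ?c + \<rho> * (?b * ?d))\<^sup>2 = \<rho> * (?a * ?d - ?b * ?c)\<^sup>2"
      by (rule square_identity)
    moreover have "0 \<le> \<rho> * (?a * ?d - ?b * ?c)\<^sup>2" using assms by simp
    ultimately show "(?a * ?c + \<rho> * (?b * ?d))\<^sup>2 \<le> (?a\<^sup>2 + \<rho> * ?b\<^sup>2) * (?c\<^sup>2 + \<rho> * ?d\<^sup>2)" by linarith
  qed
  also have "\<dots> \<le> sqrt (?P powr (2 / r) * ?Q powr (2 / r))"
    using assms by (intro real_sqrt_le_mono mult_mono two_point_norm) auto
  also have "\<dots> = ?P powr (1 / r) * ?Q powr (1 / r)"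
    by (simp add: real_sqrt_mult powr_half_sqrt[symmetric] powr_powr)
  finally show ?thesis .
qed

text \<open>In the definition of noise sensitivity \<open>\<epsilon>\<close> may exceed 1, which
  acts as certain resampling.\<close>

lemma bernoulli_pmf_min: "bernoulli_pmf (min 1 p) = bernoulli_pmf p"
proof -
  have "min 1 (max 0 (min 1 (id p))) = min 1 (max 0 (id p))" by linarith
  then show ?thesis unfolding bernoulli_pmf_def map_fun_def o_def id_def by (simp only:)
qed

lemma expectation_uniform_pair:
  fixes f :: "real \<Rightarrow> real"
  assumes "a \<noteq> b"
  shows "measure_pmf.expectation (pmf_of_set {a, b}) f = (f a + f b) / 2"
  using assms by (subst integral_pmf_of_set) auto

lemma finite_resample_one: "finite (set_pmf (resample_one a b \<epsilon>))"
  unfolding resample_one_def by simp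

text \<open>\<open>\<rho>\<close> is the probability of keeping the weight, which is also the
  correlation of the two weights; they agree with probability
  \<open>(1 + \<rho>) / 2\<close>.\<close>

lemma expectation_resample_one:
  fixes f :: "real \<times> real \<Rightarrow> real"
  assumes "a \<noteq> b" and "0 < \<epsilon>"
  defines "\<rho> \<equiv> 1 - min 1 \<epsilon>"
  shows "measure_pmf.expectation (resample_one a b \<epsilon>) f =
    (1 + \<rho>) / 4 * (f (a, a) + f (b, b)) + (1 - \<rho>) / 4 * (f (a, b) + f (b, a))"
proof -
  let ?U = "pmf_of_set {a, b}" and ?B = "bernoulli_pmf (min 1 \<epsilon>)"
  have "resample_one a b \<epsilon> = map_pmf (\<lambda>(x, r, y). (x, if r then y else x)) (pair_pmf ?U (pair_pmf ?B ?U))"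
    unfolding resample_one_def bernoulli_pmf_min pair_pmf_def map_pmf_def
    by (simp add: bind_assoc_pmf bind_return_pmf)
  then have "measure_pmf.expectation (resample_one a b \<epsilon>) f = measure_pmf.expectation ?U (\<lambda>x.
      measure_pmf.expectation ?B (\<lambda>r. measure_pmf.expectation ?U (\<lambda>y. f (x, if r then y else x))))"
    by (simp add: expectation_pair_pmf_finite)
  also have "\<dots> = (1 + \<rho>) / 4 * (f (a, a) + f (b, b)) + (1 - \<rho>) / 4 * (f (a, b) + f (b, a))"
    using assms by (simp add: expectation_uniform_pair integral_bernoulli_pmf \<rho>_def field_simps)
  finally show ?thesis .
qed

lemma map_fst_resample_one: "map_pmf fst (resample_one a b \<epsilon>) = pmf_of_set {a, b}"
  unfolding resample_one_def by (simp add: map_bind_pmf bind_return_pmf')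

lemma map_snd_resample_one:
  assumes "a \<noteq> b" and "0 < \<epsilon>"
  shows "map_pmf snd (resample_one a b \<epsilon>) = pmf_of_set {a, b}"
proof (rule pmf_eqI)
  fix v
  have "pmf (map_pmf snd (resample_one a b \<epsilon>)) v =
      measure_pmf.expectation (resample_one a b \<epsilon>) (indicator (snd -` {v}))"
    by (simp add: pmf_map)
  also have "\<dots> = (indicator {v} a + indicator {v} b) / 2"
    by (subst expectation_resample_one[OF assms]) (simp add: indicator_def field_simps)
  also have "\<dots> = pmf (pmf_of_set {a, b}) v"
    using assms(1) by (auto simp: indicator_def)
  finally show "pmf (map_pmf snd (resample_one a b \<epsilon>)) v = pmf (pmf_of_set {a, b}) v" .
qed

lemma noise_pmf_marginals:
  assumes "a \<noteq> b" and "0 < \<epsilon>" and "finite E"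
  shows "map_pmf fst (noise_pmf a b \<epsilon> E) = weight_pmf a b E"
    and "map_pmf snd (noise_pmf a b \<epsilon> E) = weight_pmf a b E"
  using Pi_pmf_map[OF assms(3), of fst "(a, a)" a "\<lambda>_. resample_one a b \<epsilon>"]
    Pi_pmf_map[OF assms(3), of snd "(a, a)" a "\<lambda>_. resample_one a b \<epsilon>"]
  unfolding noise_pmf_def weight_pmf_def
  by (simp_all add: map_fst_resample_one map_snd_resample_one[OF assms(1,2)] map_pmf_comp o_def)

lemma prob_noise_pmf_both:
  "measure_pmf.prob (noise_pmf a b \<epsilon> E) {(\<omega>, \<omega>'). A \<omega> \<and> A \<omega>'} =
    measure_pmf.prob (Pi_pmf E (a, a) (\<lambda>_. resample_one a b \<epsilon>)) {F. A (fst \<circ> F) \<and> A (snd \<circ> F)}"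
  unfolding noise_pmf_def by (simp add: vimage_def o_def)

text \<open>Tensorisation by induction on \<open>E\<close>. With both values at \<open>x\<close>
  fixed, the induction hypothesis bounds the inner expectation by a product of norms, one depending
  on the old and one on the new value at \<open>x\<close>. The two-point inequality then applies to
  these norms as functions on two points.\<close>

lemma noise_hypercontractive:
  fixes F G :: "('e \<Rightarrow> real) \<Rightarrow> real"
  assumes "a \<noteq> b" "0 < \<epsilon>" "1 < r" "r < 2" "1 - min 1 \<epsilon> \<le> r - 1" "finite E"
    and "\<And>\<omega>. 0 \<le> F \<omega>" "\<And>\<omega>. 0 \<le> G \<omega>"
  shows "measure_pmf.expectation (Pi_pmf E (a, a) (\<lambda>_. resample_one a b \<epsilon>)) (\<lambda>\<omega>. F (fst \<circ> \<omega>) * G (snd \<circ> \<omega>))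
    \<le> (measure_pmf.expectation (Pi_pmf E a (\<lambda>_. pmf_of_set {a, b})) (\<lambda>\<omega>. F \<omega> powr r)) powr (1 / r)
    * (measure_pmf.expectation (Pi_pmf E a (\<lambda>_. pmf_of_set {a, b})) (\<lambda>\<omega>. G \<omega> powr r)) powr (1 / r)"
  using assms(6-8)
proof (induction E arbitrary: F G rule: finite_induct)
  case empty
  then show ?case using assms(3) by (simp add: o_def powr_powr)
next
  case (insert x E)
  let ?R = "resample_one a b \<epsilon>" and ?U = "pmf_of_set {a, b}"
  let ?P = "Pi_pmf E (a, a) (\<lambda>_. ?R)" and ?W = "Pi_pmf E a (\<lambda>_. ?U)"
  define nrm where "nrm H u = (measure_pmf.expectation ?W (\<lambda>\<omega>. H (fun_upd \<omega> x u) powr r)) powr (1 / r)"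
    for H :: "('e \<Rightarrow> real) \<Rightarrow> real" and u
  have fin: "finite (set_pmf ?P)" "finite (set_pmf ?W)"
    using insert.hyps(1) by (simp_all add: finite_set_Pi_pmf finite_resample_one)
  have nrm_nonneg: "0 \<le> nrm H u" for H u unfolding nrm_def by simp
  have nrm_powr: "nrm H u powr r = measure_pmf.expectation ?W (\<lambda>\<omega>. H (fun_upd \<omega> x u) powr r)" for H u
    using assms(3) by (simp add: nrm_def powr_powr Bochner_Integration.integral_nonneg)
  have norm_insert: "measure_pmf.expectation (Pi_pmf (insert x E) a (\<lambda>_. ?U)) (\<lambda>\<omega>. H \<omega> powr r) =
      (nrm H a powr r + nrm H b powr r) / 2" for H
  proof -
    have "measure_pmf.expectation (Pi_pmf (insert x E) a (\<lambda>_. ?U)) (\<lambda>\<omega>. H \<omega> powr r) =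
        measure_pmf.expectation (pair_pmf ?U ?W) (\<lambda>(u, \<omega>). H (fun_upd \<omega> x u) powr r)"
      by (simp add: Pi_pmf_insert[OF insert.hyps] split_def)
    also have "\<dots> = measure_pmf.expectation ?U (\<lambda>u. nrm H u powr r)"
      using fin by (simp add: expectation_pair_pmf_finite nrm_powr)
    also have "\<dots> = (nrm H a powr r + nrm H b powr r) / 2"
      by (rule expectation_uniform_pair[OF assms(1)])
    finally show ?thesis .
  qed
  have upd: "fst \<circ> fun_upd \<omega> x z = fun_upd (fst \<circ> \<omega>) x (fst z)" "snd \<circ> fun_upd \<omega> x z = fun_upd (snd \<circ> \<omega>) x (snd z)"
    for \<omega> :: "'e \<Rightarrow> real \<times> real" and z by auto
  have "measure_pmf.expectation (Pi_pmf (insert x E) (a, a) (\<lambda>_. ?R)) (\<lambda>\<omega>. F (fst \<circ> \<omega>) * G (snd \<circ> \<omega>)) =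
      measure_pmf.expectation (pair_pmf ?R ?P)
        (\<lambda>(z, \<omega>). F (fun_upd (fst \<circ> \<omega>) x (fst z)) * G (fun_upd (snd \<circ> \<omega>) x (snd z)))"
    by (simp add: Pi_pmf_insert[OF insert.hyps] split_def upd)
  also have "\<dots> = measure_pmf.expectation ?R (\<lambda>z. measure_pmf.expectation ?P
      (\<lambda>\<omega>. F (fun_upd (fst \<circ> \<omega>) x (fst z)) * G (fun_upd (snd \<circ> \<omega>) x (snd z))))"
    using fin by (simp add: expectation_pair_pmf_finite finite_resample_one)
  also have "\<dots> \<le> measure_pmf.expectation ?R (\<lambda>z. nrm F (fst z) * nrm G (snd z))"
    unfolding nrm_def using insert.prems
    by (intro integral_mono integrable_measure_pmf_finite finite_resample_one
      insert.IH[of "\<lambda>\<omega>. F (fun_upd \<omega> x u)" "\<lambda>\<omega>. G (fun_upd \<omega> x v)" for u v]) auto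
  also have "\<dots> \<le> ((nrm F a powr r + nrm F b powr r) / 2) powr (1 / r) * ((nrm G a powr r + nrm G b powr r) / 2) powr (1 / r)"
    unfolding expectation_resample_one[OF assms(1,2)] fst_conv snd_conv
    by (rule two_point_hypercontractive) (use assms nrm_nonneg in auto)
  finally show ?case unfolding norm_insert .
qed

text \<open>Hypercontractivity with both functions the indicator of \<open>A\<close>, which equals
  its \<open>r\<close>-th power. The gain over the trivial bound is the exponent
  \<open>2 / r > 1\<close>.\<close>

lemma noise_small_set:
  assumes "a \<noteq> b" "0 < \<epsilon>" "1 < r" "r < 2" "1 - min 1 \<epsilon> \<le> r - 1" "finite E"
  shows "measure_pmf.prob (noise_pmf a b \<epsilon> E) {(\<omega>, \<omega>'). \<omega> \<in> A \<and> \<omega>' \<in> A}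
    \<le> (measure_pmf.prob (weight_pmf a b E) A) powr (2 / r)"
proof -
  let ?I = "indicator A :: (edge \<Rightarrow> real) \<Rightarrow> real"
  have "measure_pmf.prob (noise_pmf a b \<epsilon> E) {(\<omega>, \<omega>'). \<omega> \<in> A \<and> \<omega>' \<in> A} =
      measure_pmf.prob (Pi_pmf E (a, a) (\<lambda>_. resample_one a b \<epsilon>)) {\<omega>. fst \<circ> \<omega> \<in> A \<and> snd \<circ> \<omega> \<in> A}"
    by (rule prob_noise_pmf_both)
  also have "\<dots> = measure_pmf.expectation (Pi_pmf E (a, a) (\<lambda>_. resample_one a b \<epsilon>))
      (indicator {\<omega>. fst \<circ> \<omega> \<in> A \<and> snd \<circ> \<omega> \<in> A})" by simp
  also have "\<dots> = measure_pmf.expectation (Pi_pmf E (a, a) (\<lambda>_. resample_one a b \<epsilon>))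
      (\<lambda>\<omega>. ?I (fst \<circ> \<omega>) * ?I (snd \<circ> \<omega>))"
    by (intro Bochner_Integration.integral_cong) (auto simp: indicator_def)
  also have "\<dots> \<le> (measure_pmf.expectation (weight_pmf a b E) (\<lambda>\<omega>. ?I \<omega> powr r)) powr (1 / r)
      * (measure_pmf.expectation (weight_pmf a b E) (\<lambda>\<omega>. ?I \<omega> powr r)) powr (1 / r)"
    unfolding weight_pmf_def by (intro noise_hypercontractive assms) auto
  also have "(\<lambda>\<omega>. ?I \<omega> powr r) = ?I"
    by (auto simp: indicator_def)
  also have "measure_pmf.expectation (weight_pmf a b E) ?I = measure_pmf.prob (weight_pmf a b E) A" by simp
  also have "measure_pmf.prob (weight_pmf a b E) A powr (1 / r) * measure_pmf.prob (weight_pmf a b E) A powr (1 / r)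
      = measure_pmf.prob (weight_pmf a b E) A powr (2 / r)"
    by (simp add: powr_add[symmetric])
  finally show ?thesis .
qed

section \<open>Decomposition into strips\<close>

definition shift :: "int \<Rightarrow> vtx \<Rightarrow> vtx" where
  "shift i p = (fst p, snd p + i)"

definition shift_edge :: "int \<Rightarrow> edge \<Rightarrow> edge" where
  "shift_edge i e = (shift i (fst e), shift i (snd e))"

lemma inj_shift_edge: "inj (shift_edge i)"
  by (auto simp: inj_def shift_edge_def shift_def prod_eq_iff)

lemma shift_edge_in_strip_iff: "shift_edge i e \<in> strip n k i \<longleftrightarrow> e \<in> strip n k 0"
  by (cases e; cases "fst e"; cases "snd e") (auto simp: shift_edge_def shift_def strip_def Zedges_def rect_def)

lemma bij_betw_shift_edge: "bij_betw (shift_edge i) (strip n k 0) (strip n k i)"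
proof -
  have "e \<in> shift_edge i ` strip n k 0" if "e \<in> strip n k i" for e
  proof -
    have "e = shift_edge i (shift_edge (- i) e)" by (simp add: shift_edge_def shift_def)
    with that show ?thesis using shift_edge_in_strip_iff by (metis image_eqI)
  qed
  then have "shift_edge i ` strip n k 0 = strip n k i"
    using shift_edge_in_strip_iff by blast
  then show ?thesis using inj_shift_edge unfolding bij_betw_def by (metis inj_on_subset subset_UNIV)
qed

lemma canon_edge_shift: "canon_edge (shift i p) (shift i q) = shift_edge i (canon_edge p q)"
  by (simp add: canon_edge_def shift_edge_def shift_def)

lemma path_edges_shift: "path_edges (map (shift i) xs) = shift_edge i ` path_edges xs"
  unfolding path_edges_def
  by (auto simp: canon_edge_shift image_iff nth_map) (metis Suc_lessD canon_edge_shift nth_map)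

lemma passage_time_shift: "passage_time \<omega> (map (shift i) xs) = passage_time (\<omega> \<circ> shift_edge i) xs"
  unfolding passage_time_def path_edges_shift
  by (subst sum.reindex) (auto intro: inj_on_subset[OF inj_shift_edge])

lemma map_shift_crossing:
  assumes "xs \<in> crossing_paths n k j"
  shows "map (shift i) xs \<in> crossing_paths n k (j + i)"
proof -
  have "xs \<noteq> []" using crossing_pathsD(1)[OF assms] .
  then show ?thesis
    using assms unfolding crossing_paths_def nn_path_def
    by (auto simp: adj_def shift_def rect_def hd_map last_map)
qed

lemma crossing_paths_shift: "crossing_paths n k i = map (shift i) ` crossing_paths n k 0"
proof (intro equalityI subsetI)
  fix xs assume "xs \<in> crossing_paths n k i"
  then have "map (shift (- i)) xs \<in> crossing_paths n k 0"
    using map_shift_crossing[of xs n k i "- i"] by simp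
  moreover have "xs = map (shift i) (map (shift (- i)) xs)"
    by (simp add: shift_def o_def)
  ultimately show "xs \<in> map (shift i) ` crossing_paths n k 0" by blast
next
  fix xs assume "xs \<in> map (shift i) ` crossing_paths n k 0"
  then show "xs \<in> crossing_paths n k i" using map_shift_crossing[of _ n k 0 i] by auto
qed

lemma crossing_time_shift: "crossing_time \<omega> n k i = crossing_time (\<omega> \<circ> shift_edge i) n k 0"
  unfolding crossing_time_def crossing_paths_shift[of n k i] image_image passage_time_shift ..

section \<open>Independence of the strips\<close>

definition strip_offset :: "nat \<Rightarrow> nat \<Rightarrow> int" where
  "strip_offset k i = int ((i - 1) * k)"

lemma strip_row:
  assumes "0 < k" and "e \<in> strip n k (strip_offset k i)"
  shows "nat (snd (fst e)) div k = i - 1"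
proof -
  have "int ((i - 1) * k) \<le> snd (fst e)" "snd (fst e) < int ((i - 1) * k) + int k"
    using assms(2) by (auto simp: strip_def rect_def strip_offset_def)
  then have "(i - 1) * k \<le> nat (snd (fst e))" "nat (snd (fst e)) < Suc (i - 1) * k"
    by (auto simp del: of_nat_mult simp: le_nat_iff nat_less_iff)
  then show ?thesis using assms(1) by (intro div_nat_eqI) (auto simp: mult.commute)
qed

lemma disjoint_strips:
  assumes "0 < k"
  shows "disjoint_family_on (\<lambda>i. strip n k (strip_offset k i)) {1..m}"
  unfolding disjoint_family_on_def
proof (intro ballI impI equals0I)
  fix i j e assume ij: "i \<in> {1..m}" "j \<in> {1..m}" "i \<noteq> j"
    and "e \<in> strip n k (strip_offset k i) \<inter> strip n k (strip_offset k j)"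
  then have "i - 1 = j - 1" using strip_row[OF assms] by (metis IntE)
  with ij show False by auto
qed

lemma strip_subset_relevant:
  assumes "i \<in> {1..n div k}"
  shows "strip n k (strip_offset k i) \<subseteq> relevant_edges n k"
proof -
  have "(i - 1) * k + k = i * k" using assms by (cases i) auto
  also have "\<dots> \<le> n div k * k" using assms by (intro mult_le_mono1) auto
  finally have "int ((i - 1) * k) + int k \<le> int (n div k * k)" by linarith
  then have "rect n k (strip_offset k i) \<subseteq> {0..int n} \<times> {0..int (n div k * k) - 1}"
    unfolding rect_def strip_offset_def by (auto simp del: of_nat_mult)
  then show ?thesis unfolding strip_def relevant_edges_def by blast
qed

lemma finite_relevant_edges: "finite (relevant_edges n k)"
  by (rule finite_subset[of _ "({0..int n} \<times> {0..int (n div k * k) - 1}) \<times> ({0..int n} \<times> {0..int (n div k * k) - 1})"])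
    (auto simp: relevant_edges_def)

text \<open>The value type is arbitrary because the lemma serves twice: for single weights and for
  the pairs of weights before and after the noise.\<close>

lemma prob_all_strips:
  fixes f :: "'v pmf"
  assumes "0 < k" and "finite (set_pmf f)" and dep: "depends_on (strip n k 0) \<Psi>"
  shows "measure_pmf.prob (Pi_pmf (relevant_edges n k) d (\<lambda>_. f))
      {\<omega>. \<forall>i\<in>{1..n div k}. \<Psi> (\<omega> \<circ> shift_edge (strip_offset k i))} =
    measure_pmf.prob (Pi_pmf (strip n k 0) d (\<lambda>_. f)) {\<omega>. \<Psi> \<omega>} ^ (n div k)"
proof -
  let ?S = "\<lambda>i. strip n k (strip_offset k i)"
  let ?D = "Pi_pmf (relevant_edges n k) d (\<lambda>_. f)"
  define g where "g i \<omega> = (of_bool (\<Psi> (\<omega> \<circ> shift_edge (strip_offset k i))) :: real)" for i \<omega>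
  have "measure_pmf.prob ?D {\<omega>. \<forall>i\<in>{1..n div k}. \<Psi> (\<omega> \<circ> shift_edge (strip_offset k i))} =
      measure_pmf.expectation ?D (indicator {\<omega>. \<forall>i\<in>{1..n div k}. \<Psi> (\<omega> \<circ> shift_edge (strip_offset k i))})"
    by simp
  also have "\<dots> = measure_pmf.expectation ?D (\<lambda>\<omega>. \<Prod>i\<in>{1..n div k}. g i \<omega>)"
    by (intro Bochner_Integration.integral_cong) (auto simp: indicator_def g_def)
  also have "\<dots> = (\<Prod>i\<in>{1..n div k}. measure_pmf.expectation (Pi_pmf (?S i) d (\<lambda>_. f)) (g i))"
  proof (intro expectation_Pi_pmf_prod finite_relevant_edges strip_subset_relevant disjoint_strips assms(1,2))
    fix i
    show "depends_on (?S i) (g i)"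
      unfolding depends_on_def g_def
      by (intro allI impI arg_cong[where f = of_bool] depends_onD[OF dep])
        (simp add: shift_edge_in_strip_iff)
  qed auto
  also have "\<dots> = (\<Prod>i\<in>{1..n div k}. measure_pmf.prob (Pi_pmf (strip n k 0) d (\<lambda>_. f)) {\<omega>. \<Psi> \<omega>})"
  proof (rule prod.cong[OF refl])
    fix i
    have "Pi_pmf (strip n k 0) d (\<lambda>_. f) = map_pmf (\<lambda>\<omega>. \<omega> \<circ> shift_edge (strip_offset k i)) (Pi_pmf (?S i) d (\<lambda>_. f))"
      by (intro Pi_pmf_bij_betw finite_strip bij_betw_shift_edge) (simp add: shift_edge_in_strip_iff)
    then have "measure_pmf.prob (Pi_pmf (strip n k 0) d (\<lambda>_. f)) {\<omega>. \<Psi> \<omega>} =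
        measure_pmf.expectation (Pi_pmf (?S i) d (\<lambda>_. f)) (indicator {\<omega>. \<Psi> (\<omega> \<circ> shift_edge (strip_offset k i))})"
      by (simp add: vimage_def)
    also have "indicator {\<omega>. \<Psi> (\<omega> \<circ> shift_edge (strip_offset k i))} = g i"
      by (auto simp: g_def indicator_def fun_eq_iff)
    finally show "measure_pmf.expectation (Pi_pmf (?S i) d (\<lambda>_. f)) (g i) =
        measure_pmf.prob (Pi_pmf (strip n k 0) d (\<lambda>_. f)) {\<omega>. \<Psi> \<omega>}" by simp
  qed
  finally show ?thesis by simp
qed

definition strip_prob :: "real \<Rightarrow> real \<Rightarrow> nat \<Rightarrow> nat \<Rightarrow> (real \<Rightarrow> bool) \<Rightarrow> real" where
  "strip_prob a b n k \<phi> =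
    measure_pmf.prob (weight_pmf a b (strip n k 0)) {\<omega>. \<phi> (crossing_time \<omega> n k 0)}"

lemma tau_star_iff:
  assumes "0 < n div k"
  shows "q < tau_star \<omega> n k \<longleftrightarrow> (\<forall>i\<in>{1..n div k}. q < crossing_time (\<omega> \<circ> shift_edge (strip_offset k i)) n k 0)"
    and "q \<le> tau_star \<omega> n k \<longleftrightarrow> (\<forall>i\<in>{1..n div k}. q \<le> crossing_time (\<omega> \<circ> shift_edge (strip_offset k i)) n k 0)"
proof -
  have "tau_star \<omega> n k = Min ((\<lambda>i. crossing_time (\<omega> \<circ> shift_edge (strip_offset k i)) n k 0) ` {1..n div k})"
    unfolding tau_star_def strip_offset_def by (subst crossing_time_shift) (rule refl)
  then show "q < tau_star \<omega> n k \<longleftrightarrow> (\<forall>i\<in>{1..n div k}. q < crossing_time (\<omega> \<circ> shift_edge (strip_offset k i)) n k 0)"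
    and "q \<le> tau_star \<omega> n k \<longleftrightarrow> (\<forall>i\<in>{1..n div k}. q \<le> crossing_time (\<omega> \<circ> shift_edge (strip_offset k i)) n k 0)"
    using assms by auto
qed

lemma prob_tau_star:
  assumes "0 < k" and "0 < n div k"
  shows "measure_pmf.prob (weight_pmf a b (relevant_edges n k)) {\<omega>. q < tau_star \<omega> n k} = strip_prob a b n k (\<lambda>x. q < x) ^ (n div k)"
    and "measure_pmf.prob (weight_pmf a b (relevant_edges n k)) {\<omega>. q \<le> tau_star \<omega> n k} = strip_prob a b n k (\<lambda>x. q \<le> x) ^ (n div k)"
proof -
  have "depends_on (strip n k 0) (\<lambda>\<omega>. \<phi> (crossing_time \<omega> n k 0))" for \<phi> :: "real \<Rightarrow> bool"
    using depends_on_crossing_time[of n k 0] unfolding depends_on_def by metis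
  note * = prob_all_strips[OF assms(1) _ this]
  show "measure_pmf.prob (weight_pmf a b (relevant_edges n k)) {\<omega>. q < tau_star \<omega> n k} = strip_prob a b n k (\<lambda>x. q < x) ^ (n div k)"
    unfolding tau_star_iff[OF assms(2)] strip_prob_def weight_pmf_def by (rule *) simp
  show "measure_pmf.prob (weight_pmf a b (relevant_edges n k)) {\<omega>. q \<le> tau_star \<omega> n k} = strip_prob a b n k (\<lambda>x. q \<le> x) ^ (n div k)"
    unfolding tau_star_iff[OF assms(2)] strip_prob_def weight_pmf_def by (rule *) simp
qed

lemma prob_noise_tau_star:
  assumes "0 < k" and "0 < n div k"
  shows "measure_pmf.prob (noise_pmf a b \<epsilon> (relevant_edges n k)) {(\<omega>, \<omega>'). q < tau_star \<omega> n k \<and> q < tau_star \<omega>' n k} =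
    measure_pmf.prob (noise_pmf a b \<epsilon> (strip n k 0)) {(\<omega>, \<omega>'). q < crossing_time \<omega> n k 0 \<and> q < crossing_time \<omega>' n k 0} ^ (n div k)"
proof -
  let ?\<Psi> = "\<lambda>F :: edge \<Rightarrow> real \<times> real. q < crossing_time (fst \<circ> F) n k 0 \<and> q < crossing_time (snd \<circ> F) n k 0"
  have dep: "depends_on (strip n k 0) ?\<Psi>"
    unfolding depends_on_def
  proof (intro allI impI)
    fix F F' :: "edge \<Rightarrow> real \<times> real" assume eq: "\<forall>e\<in>strip n k 0. F e = F' e"
    have "crossing_time (fst \<circ> F) n k 0 = crossing_time (fst \<circ> F') n k 0"
      "crossing_time (snd \<circ> F) n k 0 = crossing_time (snd \<circ> F') n k 0"
      using eq by (auto intro!: depends_onD[OF depends_on_crossing_time])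
    then show "?\<Psi> F = ?\<Psi> F'" by simp
  qed
  have iff: "(q < tau_star (fst \<circ> F) n k \<and> q < tau_star (snd \<circ> F) n k) \<longleftrightarrow>
      (\<forall>i\<in>{1..n div k}. ?\<Psi> (F \<circ> shift_edge (strip_offset k i)))" for F
    unfolding tau_star_iff[OF assms(2)] o_assoc by blast
  show ?thesis
    unfolding prob_noise_pmf_both iff by (rule prob_all_strips[OF assms(1) finite_resample_one dep])
qed

lemma strip_atom_le:
  assumes "a < b" "0 < k" "0 < n div k" "0 < L" "16 * L\<^sup>2 \<le> card (strip n k 0)"
  shows "strip_prob a b n k (\<lambda>x. x = q) \<le> (9/10) ^ (n div k)
    + exp (- real (card (strip n k 0)) / (128 * (real L)\<^sup>2))
    + 16 * real (card (strip n k 0)) / (real (n div k) * real L) * strip_prob a b n k (\<lambda>x. x < q)"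
proof -
  let ?S = "strip n k 0" and ?J = "n div k"
  let ?X = "\<lambda>B. crossing_time (conf a b B) n k 0"
  let ?U = "pmf_of_set (Pow ?S)" and ?W = "weight_pmf a b (strip n k 0)"
  have W: "?W = map_pmf (conf a b) ?U"
    using assms(1) by (intro weight_pmf_conv_Pow finite_strip) simp
  have conv: "strip_prob a b n k \<phi> = measure_pmf.prob ?U {B. \<phi> (?X B)}" for \<phi>
    unfolding strip_prob_def W by (simp add: vimage_def)
  have mono: "?X (B - {e}) \<le> ?X B" for B e
    using assms(1,2) by (intro crossing_time_mono) (auto simp: conf_def)
  \<comment> \<open>The threshold for drops is one eighth of the number of blocks, so that few drops
    force few uncrossed blocks. It produces the factor \<open>16 = 2 * 8\<close>.\<close>
  have M: "0 < real ?J / 8" using assms(3) by simp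
  have "measure_pmf.prob ?U {B. \<not> real ?J / 8 \<le> real (card (drops ?X B))} \<le>
      measure_pmf.prob ?U {B. 8 * card {j. j < ?J \<and> \<not> block_crossed a k j (conf a b B)} < ?J}"
  proof (rule measure_pmf.finite_measure_mono_AE)
    show "AE B in ?U. B \<in> {B. \<not> real ?J / 8 \<le> real (card (drops ?X B))} \<longrightarrow>
        B \<in> {B. 8 * card {j. j < ?J \<and> \<not> block_crossed a k j (conf a b B)} < ?J}"
      unfolding AE_measure_pmf_iff
    proof (intro ballI impI)
      fix B assume B: "B \<in> set_pmf ?U" "B \<in> {B. \<not> real ?J / 8 \<le> real (card (drops ?X B))}"
      moreover have "set_pmf ?U = Pow ?S" by (intro set_pmf_of_set) (auto simp: finite_strip)
      ultimately have "B \<subseteq> ?S" by simp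
      from many_decreasing_flips[OF assms(1,2) this] B(2)
      show "B \<in> {B. 8 * card {j. j < ?J \<and> \<not> block_crossed a k j (conf a b B)} < ?J}"
        unfolding drops_def by simp
    qed
  qed simp
  also have "\<dots> = measure_pmf.prob ?W {\<omega>. 8 * card {j. j < ?J \<and> \<not> block_crossed a k j \<omega>} < ?J}"
    unfolding W by (simp add: vimage_def)
  also have "\<dots> \<le> (9/10) ^ ?J"
    using assms(1) by (intro prob_few_uncrossed_blocks finite_strip block_subset_strip disjoint_blocks) auto
  finally have bad: "measure_pmf.prob ?U {B. \<not> real ?J / 8 \<le> real (card (drops ?X B))} \<le> (9/10) ^ ?J" .
  from atom_prob_le[where X = ?X and S = ?S, OF finite_strip mono M assms(4,5), of q] bad
  show ?thesis unfolding conv by simp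
qed

section \<open>Asymptotics\<close>

text \<open>Since \<open>1 - u \<le> exp (- u)\<close>. This turns a lower bound for the probability
  that all strips avoid an event into an upper bound for the mean number of strips in which it
  occurs.\<close>

lemma mult_le_neg_ln:
  fixes u c :: real
  assumes "u \<le> 1" "0 < c" "c \<le> (1 - u) ^ m"
  shows "real m * u \<le> - ln c"
proof -
  have "c \<le> exp (- u) ^ m"
    using assms exp_ge_add_one_self[of "- u"] by (intro order_trans[OF assms(3)] power_mono) auto
  also have "\<dots> = exp (- (real m * u))" by (simp add: exp_of_nat_mult[symmetric])
  finally have "ln c \<le> ln (exp (- (real m * u)))" using assms(2) by (subst ln_le_cancel_iff) auto
  then show ?thesis by simp
qed

lemma real_div_ge:
  assumes "0 < k" and "real k \<le> x"
  shows "real n / x - 1 \<le> real (n div k)"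
proof -
  have "0 < x" using assms by linarith
  have "real n / x \<le> real n / real k" using assms by (intro divide_left_mono) auto
  also have "\<dots> \<le> of_int \<lfloor>real n / real k\<rfloor> + 1" by linarith
  also have "\<lfloor>real n / real k\<rfloor> = int (n div k)" by (rule floor_divide_of_nat_eq)
  finally show ?thesis by simp
qed

lemma filterlim_div_at_top:
  assumes "\<And>n. 0 < k n" and "eventually (\<lambda>n. real (k n) \<le> real n powr (1/22)) sequentially"
  shows "filterlim (\<lambda>n. real (n div k n)) at_top sequentially"
proof (rule filterlim_at_top_mono)
  show "filterlim (\<lambda>n. real n / real n powr (1/22) - 1) at_top sequentially" by real_asymp
  from assms(2) show "eventually (\<lambda>n. real n / real n powr (1/22) - 1 \<le> real (n div k n)) sequentially"
    by eventually_elim (intro real_div_ge assms(1))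
qed

lemma strip_prob_nonneg: "0 \<le> strip_prob a b n k \<phi>" and strip_prob_le_1: "strip_prob a b n k \<phi> \<le> 1"
  unfolding strip_prob_def by simp_all

lemma strip_prob_ge: "strip_prob a b n k (\<lambda>x. q \<le> x) = 1 - strip_prob a b n k (\<lambda>x. x < q)"
proof -
  have "{\<omega>. q \<le> crossing_time \<omega> n k 0} = UNIV - {\<omega>. crossing_time \<omega> n k 0 < q}" by auto
  then show ?thesis unfolding strip_prob_def by (simp add: measure_pmf.prob_compl[of _ "weight_pmf a b (strip n k 0)", simplified])
qed

lemma strip_prob_ge_split:
  "strip_prob a b n k (\<lambda>x. q \<le> x) = strip_prob a b n k (\<lambda>x. q < x) + strip_prob a b n k (\<lambda>x. x = q)"
proof -
  have "{\<omega>. q \<le> crossing_time \<omega> n k 0} = {\<omega>. q < crossing_time \<omega> n k 0} \<union> {\<omega>. crossing_time \<omega> n k 0 = q}" by auto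
  then show ?thesis unfolding strip_prob_def
    by (simp only:) (rule measure_pmf.finite_measure_Union, auto)
qed

text \<open>With \<open>L\<close> about \<open>n powr (1/4)\<close> and
  \<open>x = n powr (1/22)\<close>, a strip has at most \<open>4 * n * x\<close> edges and
  \<open>n div k n\<close> is at least \<open>n / (2 * x)\<close>. So the main coefficient in
  \<open>strip_atom_le\<close> is of order \<open>x\<^sup>2 / L\<close>, that is
  \<open>n powr (1/11 - 1/4)\<close>, which tends to 0. The other two errors decay faster than any
  power of \<open>n\<close>.\<close>

lemma strip_atom_tendsto_0:
  fixes k :: "nat \<Rightarrow> nat" and q :: "nat \<Rightarrow> real"
  assumes "a < b" and k_pos: "\<And>n. 0 < k n"
    and k_small: "eventually (\<lambda>n. real (k n) \<le> real n powr (1/22)) sequentially"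
    and u_le: "eventually (\<lambda>n. real (n div k n) * strip_prob a b n (k n) (\<lambda>x. x < q n) \<le> C) sequentially"
    and "0 \<le> C"
  shows "(\<lambda>n. real (n div k n) * strip_prob a b n (k n) (\<lambda>x. x = q n)) \<longlonglongrightarrow> 0"
proof -
  have lim_m: "filterlim (\<lambda>n. real (n div k n)) at_top sequentially"
    by (rule filterlim_div_at_top[OF k_pos k_small])
  define B where "B n = real (n div k n) * (9/10) powr (real (n div k n)) + real n * exp (- (real n powr (1/2)) / 128)
      + 256 * C * real n powr (1/11 - 1/4)" for n
  have "(\<lambda>n. real (n div k n) * (9/10) powr (real (n div k n))) \<longlonglongrightarrow> 0"
    by (rule filterlim_compose[OF _ lim_m]) real_asymp
  moreover have "(\<lambda>n::nat. real n * exp (- (real n powr (1/2)) / 128)) \<longlonglongrightarrow> 0" by real_asymp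
  moreover have "(\<lambda>n::nat. 256 * C * real n powr (1/11 - 1/4)) \<longlonglongrightarrow> 256 * C * 0"
    by (intro tendsto_mult tendsto_const) real_asymp
  ultimately have "B \<longlonglongrightarrow> 0 + 0 + 256 * C * 0"
    unfolding B_def by (intro tendsto_add)
  then have B: "B \<longlonglongrightarrow> 0" by simp
  have "eventually (\<lambda>n. 1 \<le> real (n div k n)) sequentially"
    using lim_m unfolding filterlim_at_top by blast
  moreover have "eventually (\<lambda>n. real n / real n powr (1/22) / 2 \<le> real n / real n powr (1/22) - 1) sequentially"
    by real_asymp
  ultimately have "eventually (\<lambda>n. real (n div k n) * strip_prob a b n (k n) (\<lambda>x. x = q n) \<le> B n) sequentially"
    \<comment> \<open>As \<open>256 = 4 ^ 4\<close>, here \<open>n powr (1/4) \<ge> 4\<close>, so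
      its floor \<open>L\<close> is at least half of it, and \<open>n powr (1/2) \<ge> 16\<close>
      yields \<open>16 * L\<^sup>2 \<le> N\<close>.\<close>
    using k_small u_le eventually_ge_at_top[of 256]
  proof eventually_elim
    case (elim n)
    define m N L and x y :: real
      where "m = n div k n" and "N = card (strip n (k n) 0)" and "L = nat \<lfloor>real n powr (1/4)\<rfloor>"
        and "x = real n powr (1/22)" and "y = real n powr (1/4)"
    let ?p = "strip_prob a b n (k n) (\<lambda>x. x = q n)" and ?u = "strip_prob a b n (k n) (\<lambda>x. x < q n)"
    have n: "256 \<le> n" using elim by simp
    have m: "0 < m" "real m \<le> real n" using elim by (auto simp: m_def)
    have x: "0 < x" "real (k n) \<le> x" using elim n by (auto simp: x_def)
    have yy: "y * y = real n powr (1/2)" "real n powr (1/2) * real n powr (1/2) = real n"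
      using n by (simp_all add: y_def powr_add[symmetric])
    have "(4::real) = (4 powr 4) powr (1/4)" unfolding powr_powr by simp
    also have "(4::real) powr 4 = 256" by simp
    also have "256 powr (1/4) \<le> y" unfolding y_def using n by (intro powr_mono2) auto
    finally have y: "4 \<le> y" .
    have L: "real L \<le> y" "y / 2 \<le> real L"
      using y unfolding L_def y_def[symmetric] by linarith+
    then have L0: "0 < L" using y by (cases L) auto
    have NL: "real n \<le> real N" "real N \<le> 4 * real n * x"
    proof -
      show "real n \<le> real N" using card_strip_ge[OF k_pos] by (simp add: N_def)
      have "real N \<le> real (2 * (n + 1) * k n)" unfolding N_def of_nat_le_iff by (rule card_strip_le)
      also have "2 * (n + 1) * k n \<le> 4 * n * k n" using n by (intro mult_le_mono1) simp
      then have "real (2 * (n + 1) * k n) \<le> 4 * real n * real (k n)"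
        by (simp only: of_nat_le_iff[symmetric, where 'a = real] of_nat_mult of_nat_numeral)
      also have "\<dots> \<le> 4 * real n * x" using x by (intro mult_left_mono) auto
      finally show "real N \<le> 4 * real n * x" .
    qed
    have LL: "real L * real L \<le> real n powr (1/2)"
      using L y unfolding yy(1)[symmetric] by (intro mult_mono) auto
    have s16: "16 \<le> real n powr (1/2)"
      using mult_mono[OF y y] y by (simp add: yy)
    then have "16 * real n powr (1/2) \<le> real n powr (1/2) * real n powr (1/2)"
      by (intro mult_right_mono) auto
    with LL NL(1) have "16 * (real L * real L) \<le> real N" by (simp add: yy)
    then have L16: "16 * L\<^sup>2 \<le> N"
      by (metis of_nat_le_iff of_nat_mult of_nat_numeral power2_eq_square)
    have p: "?p \<le> (9/10) ^ m + exp (- real N / (128 * (real L)\<^sup>2)) + 16 * real N / (real m * real L) * ?u"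
      unfolding m_def N_def using m L0 L16 by (intro strip_atom_le assms k_pos) (auto simp: m_def N_def)
    have "real n powr (1/2) / 128 \<le> real N / (128 * (real L)\<^sup>2)"
    proof -
      have "real n powr (1/2) * (real L)\<^sup>2 \<le> real n powr (1/2) * real n powr (1/2)"
        using LL by (intro mult_left_mono) (auto simp: power2_eq_square)
      then show ?thesis using NL L0 by (simp add: yy field_simps)
    qed
    then have t2: "real m * exp (- real N / (128 * (real L)\<^sup>2)) \<le> real n * exp (- (real n powr (1/2)) / 128)"
      using m by (intro mult_mono) auto
    have "real n / x / 2 \<le> real m"
      using elim real_div_ge[of "k n" x n] k_pos x unfolding m_def x_def by force
    then have "real n \<le> 2 * x * real m" using x by (simp add: field_simps)
    moreover have "0 \<le> 4 * x" using x by simp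
    ultimately have "4 * x * real n \<le> 4 * x * (2 * x * real m)" by (intro mult_left_mono)
    then have "16 * real N \<le> 128 * (x * x) * real m" using NL by (simp add: mult_ac)
    then have "16 * real N / real m \<le> 128 * (x * x)" using m by (simp add: field_simps)
    then have "16 * real N / real m / real L \<le> 128 * (x * x) / (y / 2)"
      using L y x by (intro frac_le) auto
    also have "\<dots> = 256 * (x * x / y)" by simp
    also have "x * x / y = real n powr (1/11 - 1/4)"
      using n by (simp add: x_def y_def powr_add[symmetric] powr_diff[symmetric])
    finally have "16 * real N / (real m * real L) \<le> 256 * real n powr (1/11 - 1/4)"
      by simp
    then have "16 * real N / (real m * real L) * (real m * ?u) \<le> 256 * real n powr (1/11 - 1/4) * C"
      using elim by (intro mult_mono) (auto simp: m_def strip_prob_nonneg)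
    then have t3: "real m * (16 * real N / (real m * real L) * ?u) \<le> 256 * C * real n powr (1/11 - 1/4)"
      by (simp add: mult_ac)
    have "real m * ?p \<le> real m * ((9/10) ^ m + exp (- real N / (128 * (real L)\<^sup>2)) + 16 * real N / (real m * real L) * ?u)"
      using p by (intro mult_left_mono) auto
    also have "\<dots> = real m * (9/10) powr (real m) + real m * exp (- real N / (128 * (real L)\<^sup>2))
        + real m * (16 * real N / (real m * real L) * ?u)"
      by (simp only: distrib_left) (simp add: powr_realpow)
    also have "\<dots> \<le> B n" using t2 t3 unfolding B_def m_def[symmetric] by linarith
    finally show ?case by (simp add: m_def)
  qed
  moreover have "eventually (\<lambda>n. 0 \<le> real (n div k n) * strip_prob a b n (k n) (\<lambda>x. x = q n)) sequentially"
    by (simp add: strip_prob_nonneg)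
  ultimately show ?thesis by (intro tendsto_sandwich[OF _ _ tendsto_const B])
qed

text \<open>\<open>P\<close> is the probability that the crossing time is at most \<open>q\<close>.
  By inclusion-exclusion \<open>Z = 1 - 2 * P + Q\<close>, where \<open>Q\<close> is the probability
  that this holds both before and after the noise. Thus the difference is
  \<open>Q - P\<^sup>2\<close>, and \<open>noise_small_set\<close> bounds \<open>Q\<close>.\<close>

lemma noise_strip_diff:
  fixes a b \<epsilon> r q :: real and n k :: nat
  assumes "a \<noteq> b" "0 < \<epsilon>" "1 < r" "r < 2" "1 - min 1 \<epsilon> \<le> r - 1"
  defines "Z \<equiv> measure_pmf.prob (noise_pmf a b \<epsilon> (strip n k 0))
      {(\<omega>, \<omega>'). q < crossing_time \<omega> n k 0 \<and> q < crossing_time \<omega>' n k 0}"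
    and "P \<equiv> 1 - strip_prob a b n k (\<lambda>x. q < x)"
  shows "\<bar>Z - (1 - P)\<^sup>2\<bar> \<le> P powr (2 / r) + P\<^sup>2"
proof -
  let ?M = "noise_pmf a b \<epsilon> (strip n k 0)"
  let ?le = "\<lambda>\<omega>. crossing_time \<omega> n k 0 \<le> q"
  define Q where "Q = measure_pmf.prob ?M {(\<omega>, \<omega>'). ?le \<omega> \<and> ?le \<omega>'}"
  have P: "measure_pmf.prob (weight_pmf a b (strip n k 0)) {\<omega>. ?le \<omega>} = P"
  proof -
    have "{\<omega>. ?le \<omega>} = UNIV - {\<omega>. q < crossing_time \<omega> n k 0}" by auto
    then show ?thesis unfolding P_def strip_prob_def
      by (simp add: measure_pmf.prob_compl[of _ "weight_pmf a b (strip n k 0)", simplified])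
  qed
  have marg: "measure_pmf.prob ?M {(\<omega>, \<omega>'). ?le \<omega>} = P" "measure_pmf.prob ?M {(\<omega>, \<omega>'). ?le \<omega>'} = P"
    using P[folded noise_pmf_marginals(1)[OF assms(1,2) finite_strip]]
      P[folded noise_pmf_marginals(2)[OF assms(1,2) finite_strip]]
    by (simp_all add: vimage_def split_def)
  have "{(\<omega>, \<omega>'). q < crossing_time \<omega> n k 0 \<and> q < crossing_time \<omega>' n k 0} =
      UNIV - ({(\<omega>, \<omega>'). ?le \<omega>} \<union> {(\<omega>, \<omega>'). ?le \<omega>'})" by auto
  then have "Z = 1 - measure_pmf.prob ?M ({(\<omega>, \<omega>'). ?le \<omega>} \<union> {(\<omega>, \<omega>'). ?le \<omega>'})"
    unfolding Z_def by (simp add: measure_pmf.prob_compl[of _ ?M, simplified])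
  also have "measure_pmf.prob ?M ({(\<omega>, \<omega>'). ?le \<omega>} \<union> {(\<omega>, \<omega>'). ?le \<omega>'}) =
      measure_pmf.prob ?M {(\<omega>, \<omega>'). ?le \<omega>} + measure_pmf.prob ?M {(\<omega>, \<omega>'). ?le \<omega>'} - measure_pmf.prob ?M ({(\<omega>, \<omega>'). ?le \<omega>} \<inter> {(\<omega>, \<omega>'). ?le \<omega>'})"
    by (rule measure_Un3) (auto simp: measure_pmf.fmeasurable_eq_sets)
  also have "{(\<omega>, \<omega>'). ?le \<omega>} \<inter> {(\<omega>, \<omega>'). ?le \<omega>'} = {(\<omega>, \<omega>'). ?le \<omega> \<and> ?le \<omega>'}" by auto
  finally have Z: "Z - (1 - P)\<^sup>2 = Q - P\<^sup>2" by (simp add: marg Q_def power2_eq_square algebra_simps)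
  have "Q \<le> P powr (2 / r)"
    using noise_small_set[OF assms(1-5) finite_strip[of n k 0], where A = "{\<omega>. ?le \<omega>}"]
    unfolding P Q_def mem_Collect_eq .
  moreover have "0 \<le> Q" by (simp add: Q_def)
  moreover have "0 \<le> P\<^sup>2" by simp
  ultimately show ?thesis unfolding Z by linarith
qed

theorem theorem5p1:
  fixes a b :: real and k :: "nat \<Rightarrow> nat"
  assumes "0 < a" and "a < b"
    and "\<And>n. 0 < k n"
    and "(\<lambda>n. real (k n)) \<in> o(\<lambda>n. real n powr (1/22))"
  shows "\<forall>\<beta> q. 0 < \<beta> \<and> \<beta> < 1 \<and>
           (\<forall>n. is_quantile (weight_pmf a b (relevant_edges n (k n)))
                              (\<lambda>\<omega>. tau_star \<omega> n (k n)) \<beta> (q n)) \<longrightarrow>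
           ((\<lambda>n. measure_pmf.prob (weight_pmf a b (relevant_edges n (k n)))
                    {\<omega>. tau_star \<omega> n (k n) < q n}) \<longlonglongrightarrow> \<beta>) \<and>
           ((\<lambda>n. measure_pmf.prob (weight_pmf a b (relevant_edges n (k n)))
                    {\<omega>. tau_star \<omega> n (k n) > q n}) \<longlonglongrightarrow> 1 - \<beta>) \<and>
           noise_sensitive a b (\<lambda>n. relevant_edges n (k n))
             (\<lambda>n \<omega>. if tau_star \<omega> n (k n) > q n then 1 else 0)"
proof (intro allI impI)
  fix \<beta> :: real and q :: "nat \<Rightarrow> real"
  assume H: "0 < \<beta> \<and> \<beta> < 1 \<and> (\<forall>n. is_quantile (weight_pmf a b (relevant_edges n (k n)))
                              (\<lambda>\<omega>. tau_star \<omega> n (k n)) \<beta> (q n))"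
  let ?W = "\<lambda>n. weight_pmf a b (relevant_edges n (k n))"
  define m where "m n = n div k n" for n
  define x where "x n = strip_prob a b n (k n) (\<lambda>x. q n \<le> x)" for n
  define y where "y n = strip_prob a b n (k n) (\<lambda>x. q n < x)" for n
  define A where "A n = measure_pmf.prob (?W n) {\<omega>. q n \<le> tau_star \<omega> n (k n)}" for n
  define B where "B n = measure_pmf.prob (?W n) {\<omega>. q n < tau_star \<omega> n (k n)}" for n
  define C where "C = - ln (1 - \<beta>)"
  have \<beta>: "0 < \<beta>" "\<beta> < 1" and C: "0 \<le> C" using H by (auto simp: C_def)
  have k_small: "eventually (\<lambda>n. real (k n) \<le> real n powr (1/22)) sequentially"
    using landau_o.smallD[OF assms(4), of 1] by simp
  have lim_m: "filterlim (\<lambda>n. real (m n)) at_top sequentially"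
    unfolding m_def by (rule filterlim_div_at_top[OF assms(3) k_small])
  then have m_pos: "eventually (\<lambda>n. 0 < m n) sequentially"
    using filterlim_at_top_dense[of "\<lambda>n. real (m n)"] by (metis (mono_tags, lifting) eventually_mono of_nat_0_less_iff)
  have compl: "measure_pmf.prob M {\<omega>. \<not> R \<omega>} = 1 - measure_pmf.prob M {\<omega>. R \<omega>}" for M :: "(edge \<Rightarrow> real) pmf" and R
    using measure_pmf.prob_compl[of "{\<omega>. R \<omega>}" M] by (simp add: Compl_eq_Diff_UNIV[symmetric] Collect_neg_eq)
  have A_eq: "A n = 1 - measure_pmf.prob (?W n) {\<omega>. tau_star \<omega> n (k n) < q n}" for n
    unfolding A_def compl[symmetric] by (simp add: not_less)
  have B_eq: "B n = 1 - measure_pmf.prob (?W n) {\<omega>. tau_star \<omega> n (k n) \<le> q n}" for n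
    unfolding B_def compl[symmetric] by (simp add: not_le)
  \<comment> \<open>The quantile condition says exactly that \<open>1 - \<beta>\<close> lies between
    \<open>B n\<close> and \<open>A n\<close>. It remains to show that their difference, the atom of
    the minimum at \<open>q n\<close>, tends to 0.\<close>
  have AB: "1 - \<beta> \<le> A n" "B n \<le> 1 - \<beta>" for n
    using H unfolding A_eq B_eq is_quantile_def by (auto simp: algebra_simps)
  have pow: "eventually (\<lambda>n. A n = x n ^ m n \<and> B n = y n ^ m n) sequentially"
    using m_pos
    by eventually_elim (auto simp: A_def B_def x_def y_def m_def intro!: prob_tau_star assms(3))
  have unit: "0 \<le> x n" "x n \<le> 1" "0 \<le> y n" "y n \<le> 1" for n
    by (simp_all add: x_def y_def strip_prob_nonneg strip_prob_le_1)
  \<comment> \<open>The mean number of strips with crossing time below \<open>q n\<close> stays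
    bounded, because \<open>A n \<ge> 1 - \<beta>\<close>.\<close>
  have mx: "eventually (\<lambda>n. real (m n) * (1 - x n) \<le> C) sequentially"
    using pow
  proof eventually_elim
    case (elim n)
    then show ?case unfolding C_def
      using AB(1)[of n] unit[of n] \<beta> by (intro mult_le_neg_ln) auto
  qed
  have u: "1 - x n = strip_prob a b n (k n) (\<lambda>x. x < q n)" for n
    unfolding x_def strip_prob_ge by simp
  have p: "x n - y n = strip_prob a b n (k n) (\<lambda>x. x = q n)" for n
    unfolding x_def y_def strip_prob_ge_split[of a b n "k n" "q n"] by simp
  have mp: "(\<lambda>n. real (m n) * (x n - y n)) \<longlonglongrightarrow> 0"
    unfolding p m_def
    using mx C unfolding u m_def by (intro strip_atom_tendsto_0 assms(2,3) k_small)
  have xy: "0 \<le> x n - y n" for n unfolding p by (rule strip_prob_nonneg)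
  \<comment> \<open>Taking \<open>j\<close>-th powers on the unit interval multiplies distances by
    at most \<open>j\<close>. This serves for the atom of the minimum and again for the
    noise.\<close>
  have pdiff: "\<bar>s ^ j - t ^ j\<bar> \<le> real j * \<bar>s - t\<bar>" if "0 \<le> s" "s \<le> 1" "0 \<le> t" "t \<le> 1" for s t :: real and j
    using norm_power_diff[of s t j] that by simp
  have diff: "eventually (\<lambda>n. A n - B n \<le> real (m n) * (x n - y n)) sequentially"
    using pow
  proof eventually_elim
    case (elim n)
    then show ?case using pdiff[OF unit(1,2)[of n] unit(3,4)[of n], of "m n"] xy[of n] by simp
  qed
  have A_lim: "A \<longlonglongrightarrow> 1 - \<beta>"
  proof (rule tendsto_sandwich[OF _ _ tendsto_const])
    show "eventually (\<lambda>n. 1 - \<beta> \<le> A n) sequentially" using AB by simp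
    show "eventually (\<lambda>n. A n \<le> 1 - \<beta> + real (m n) * (x n - y n)) sequentially"
      using diff by eventually_elim (use AB in \<open>smt (verit)\<close>)
    show "(\<lambda>n. 1 - \<beta> + real (m n) * (x n - y n)) \<longlonglongrightarrow> 1 - \<beta>"
      using tendsto_add[OF tendsto_const mp, of "1 - \<beta>"] by simp
  qed
  have B_lim: "B \<longlonglongrightarrow> 1 - \<beta>"
  proof (rule tendsto_sandwich[OF _ _ _ tendsto_const])
    show "eventually (\<lambda>n. B n \<le> 1 - \<beta>) sequentially" using AB by simp
    show "eventually (\<lambda>n. 1 - \<beta> - real (m n) * (x n - y n) \<le> B n) sequentially"
      using diff by eventually_elim (use AB in \<open>smt (verit)\<close>)
    show "(\<lambda>n. 1 - \<beta> - real (m n) * (x n - y n)) \<longlonglongrightarrow> 1 - \<beta>"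
      using tendsto_diff[OF tendsto_const mp, of "1 - \<beta>"] by simp
  qed
  have "(\<lambda>n. 1 - A n) \<longlonglongrightarrow> 1 - (1 - \<beta>)"
    by (intro tendsto_diff tendsto_const A_lim)
  then have goal1: "(\<lambda>n. measure_pmf.prob (?W n) {\<omega>. tau_star \<omega> n (k n) < q n}) \<longlonglongrightarrow> \<beta>"
    unfolding A_eq by simp
  have goal2: "(\<lambda>n. measure_pmf.prob (?W n) {\<omega>. tau_star \<omega> n (k n) > q n}) \<longlonglongrightarrow> 1 - \<beta>"
    using B_lim unfolding B_def .
  have goal3: "noise_sensitive a b (\<lambda>n. relevant_edges n (k n)) (\<lambda>n \<omega>. if tau_star \<omega> n (k n) > q n then 1 else 0)"
    unfolding noise_sensitive_def
  proof (intro allI impI)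
    fix \<epsilon> :: real assume \<epsilon>: "0 < \<epsilon>"
    let ?M = "\<lambda>n. noise_pmf a b \<epsilon> (relevant_edges n (k n))"
    \<comment> \<open>Any \<open>r\<close> strictly between 1 and 2 with \<open>r - 1\<close> at
      least the correlation will do; 3/2 keeps \<open>r\<close> above 1 when
      \<open>\<epsilon> \<ge> 1\<close>.\<close>
    define r where "r = max (2 - min 1 \<epsilon>) (3/2)"
    have r: "1 < r" "r < 2" "1 - min 1 \<epsilon> \<le> r - 1" using \<epsilon> by (auto simp: r_def)
    \<comment> \<open>The exponent gained by hypercontractivity:
      \<open>P powr (2 / r) = P * P powr s\<close>.\<close>
    define s where "s = 2 / r - 1"
    have s: "0 < s" using r by (simp add: s_def field_simps)
    define Z where "Z n = measure_pmf.prob (noise_pmf a b \<epsilon> (strip n (k n) 0))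
      {(\<omega>, \<omega>'). q n < crossing_time \<omega> n (k n) 0 \<and> q n < crossing_time \<omega>' n (k n) 0}" for n
    \<comment> \<open>Bounds the mean number of strips with crossing time at most
      \<open>q n\<close>: \<open>C\<close> for those below \<open>q n\<close>, and 1 for the atom,
      whose contribution tends to 0.\<close>
    define D where "D = C + 1"
    have "eventually (\<lambda>n. real (m n) * (x n - y n) < 1) sequentially"
      using mp by (rule order_tendstoD) simp
    with mx have mP: "eventually (\<lambda>n. real (m n) * (1 - y n) \<le> D) sequentially"
    proof eventually_elim
      case (elim n)
      have "real (m n) * (1 - y n) = real (m n) * (1 - x n) + real (m n) * (x n - y n)"
        by (simp add: algebra_simps)
      with elim show ?case by (simp add: D_def)
    qed
    have EM: "measure_pmf.expectation (?M n) (\<lambda>(\<omega>, \<omega>'). (if q n < tau_star \<omega> n (k n) then 1 else 0) * (if q n < tau_star \<omega>' n (k n) then 1 else 0))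
        = measure_pmf.prob (?M n) {(\<omega>, \<omega>'). q n < tau_star \<omega> n (k n) \<and> q n < tau_star \<omega>' n (k n)}" for n
    proof -
      have "measure_pmf.expectation (?M n) (\<lambda>(\<omega>, \<omega>'). (if q n < tau_star \<omega> n (k n) then 1 else 0) * (if q n < tau_star \<omega>' n (k n) then 1 else 0))
        = measure_pmf.expectation (?M n) (indicat_real {(\<omega>, \<omega>'). q n < tau_star \<omega> n (k n) \<and> q n < tau_star \<omega>' n (k n)})"
        by (intro Bochner_Integration.integral_cong) (auto simp: indicator_def split: if_splits)
      then show ?thesis by simp
    qed
    have EW: "measure_pmf.expectation (?W n) (\<lambda>\<omega>. if q n < tau_star \<omega> n (k n) then 1 else 0) = B n" for n
    proof -
      have "measure_pmf.expectation (?W n) (\<lambda>\<omega>. if q n < tau_star \<omega> n (k n) then 1 else 0) =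
          measure_pmf.expectation (?W n) (indicat_real {\<omega>. q n < tau_star \<omega> n (k n)})"
        by (intro Bochner_Integration.integral_cong) (auto simp: indicator_def)
      then show ?thesis by (simp add: B_def)
    qed
    have "(\<lambda>n. measure_pmf.prob (?M n) {(\<omega>, \<omega>'). q n < tau_star \<omega> n (k n) \<and> q n < tau_star \<omega>' n (k n)} - (B n)\<^sup>2) \<longlonglongrightarrow> 0"
    proof (rule Lim_null_comparison)
      show "(\<lambda>n. D * (D / real (m n)) powr s + D * (D / real (m n))) \<longlonglongrightarrow> 0"
      proof (rule filterlim_compose[OF _ lim_m])
        have "((\<lambda>t::real. D / t) \<longlongrightarrow> 0) at_top"
          by (rule tendsto_divide_0[OF tendsto_const]) (rule filterlim_at_top_imp_at_infinity[OF filterlim_ident])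
        moreover have "0 < D" using C by (simp add: D_def)
        ultimately have "((\<lambda>t::real. D * (D / t) powr s + D * (D / t)) \<longlongrightarrow> D * 0 powr s + D * 0) at_top"
          using s by (intro tendsto_intros tendsto_powr2 eventually_at_top_linorderI[of 1]) auto
        then show "((\<lambda>t::real. D * (D / t) powr s + D * (D / t)) \<longlongrightarrow> 0) at_top" by simp
      qed
      show "eventually (\<lambda>n. norm (measure_pmf.prob (?M n) {(\<omega>, \<omega>'). q n < tau_star \<omega> n (k n) \<and> q n < tau_star \<omega>' n (k n)} - (B n)\<^sup>2)
          \<le> D * (D / real (m n)) powr s + D * (D / real (m n))) sequentially"
        using pow m_pos mP
      proof eventually_elim
        case (elim n)
        let ?P = "1 - y n"
        have P: "0 \<le> ?P" "?P \<le> D / real (m n)" using elim unit[of n] by (auto simp: field_simps)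
        have Z: "measure_pmf.prob (?M n) {(\<omega>, \<omega>'). q n < tau_star \<omega> n (k n) \<and> q n < tau_star \<omega>' n (k n)} = Z n ^ m n"
          unfolding Z_def m_def using elim by (intro prob_noise_tau_star assms(3)) (simp add: m_def)
        \<comment> \<open>By independence of the strips both terms are \<open>m n\<close>-th powers,
          so it suffices to bound \<open>m n\<close> times the error of one strip. This is at most
          \<open>m n * ?P * (?P powr s + ?P)\<close>, where \<open>m n * ?P\<close> is bounded by
          \<open>D\<close> and \<open>?P\<close> tends to 0.\<close>
        have "\<bar>Z n ^ m n - (y n)\<^sup>2 ^ m n\<bar> \<le> real (m n) * \<bar>Z n - (y n)\<^sup>2\<bar>"
          using unit[of n] by (intro pdiff) (auto simp: Z_def power_le_one)
        also have "\<dots> \<le> real (m n) * (?P powr (2 / r) + ?P\<^sup>2)"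
          using noise_strip_diff[of a b \<epsilon> r n "k n" "q n"] assms(2) \<epsilon> r
          by (intro mult_left_mono) (auto simp: Z_def y_def)
        also have "\<dots> = real (m n) * ?P * (?P powr s) + real (m n) * ?P * ?P"
        proof -
          have "?P powr (2 / r) = ?P * ?P powr s"
          proof (cases "?P = 0")
            case False
            then have "?P powr (1 + s) = ?P * ?P powr s" using P by (simp add: powr_add)
            then show ?thesis by (simp add: s_def)
          qed simp
          then show ?thesis by (simp only: power2_eq_square distrib_left mult.assoc)
        qed
        also have "\<dots> \<le> D * (D / real (m n)) powr s + D * (D / real (m n))"
          using P elim s C by (intro add_mono mult_mono powr_mono2) (auto simp: D_def)
        finally show ?case using elim unfolding Z by (simp add: power_mult[symmetric] mult.commute)
      qed
    qed
    then show "(\<lambda>n. measure_pmf.expectation (?M n) (\<lambda>(\<omega>, \<omega>'). (if q n < tau_star \<omega> n (k n) then 1 else 0) * (if q n < tau_star \<omega>' n (k n) then 1 else 0))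
        - (measure_pmf.expectation (?W n) (\<lambda>\<omega>. if q n < tau_star \<omega> n (k n) then 1 else 0))\<^sup>2) \<longlonglongrightarrow> (0::real)"
      by (simp only: EM EW)
  qed
  show "((\<lambda>n. measure_pmf.prob (?W n) {\<omega>. tau_star \<omega> n (k n) < q n}) \<longlonglongrightarrow> \<beta>) \<and>
      ((\<lambda>n. measure_pmf.prob (?W n) {\<omega>. tau_star \<omega> n (k n) > q n}) \<longlonglongrightarrow> 1 - \<beta>) \<and>
      noise_sensitive a b (\<lambda>n. relevant_edges n (k n)) (\<lambda>n \<omega>. if tau_star \<omega> n (k n) > q n then 1 else 0)"
    using goal1 goal2 goal3 by blast
qed

end
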